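(* Let $\mathscr H$ be a complex Hilbert space and let $\mathbf{T}=(T_1,\dots,T_d)\in\mathbb{B}(\mathscr H)^d$ be commuting (i.e. $T_iT_j=T_jT_i$ for all $i,j$). Then the following are equivalent: (a) $r(\mathbf{T})=\|\mathbf{T}\|$; (b) $w_e(\mathbf{T})=\|\mathbf{T}\|$.
   Context: $\mathbb{B}(\mathscr H)$ denotes the bounded linear operators on $\mathscr H$. $w_e(\mathbf{T})=\sup\{(\sum_{k=1}^d|\langle T_kx,x\rangle|^2)^{1/2}: \|x\|=1\}$, $\|\mathbf{T}\|=\sup\{(\sum_{k=1}^d\|T_kx\|^2)^{1/2}: \|x\|=1\}$. For a commuting tuple, $\sigma(\mathbf{T})\subseteq\mathbb{C}^d$ is its (Taylor) joint spectrum, and the joint spectral radius is $r(\mathbf{T})=\sup\{(\sum_{k=1}^d|z_k|^2)^{1/2}:(z_1,\dots,z_d)\in\sigma(\mathbf{T})\}$. The joint approximate point spectrum $\sigma_\pi(\mathbf{T})$ is the set of $(\lambda_1,\dots,\lambda_d)\in\mathbb{C}^d$ for which there are unit vectors $x_n$ with $\|(T_k-\lambda_kI)x_n\|\to0$ for all $k$; it satisfies $\sigma_\pi(\mathbf{T})\subseteq\sigma(\mathbf{T})$, and $r(\mathbf{T})\le w_e(\mathbf{T})$ for commuting tuples. *)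

theory Defs
  imports Complex_Main
begin

class complex_inner_space = real_normed_vector +
  fixes scaleC :: "complex \<Rightarrow> 'a \<Rightarrow> 'a"
    and cinner :: "'a \<Rightarrow> 'a \<Rightarrow> complex"
  assumes scaleC_add_right: "scaleC a (x + y) = scaleC a x + scaleC a y"
    and scaleC_add_left: "scaleC (a + b) x = scaleC a x + scaleC b x"
    and scaleC_scaleC: "scaleC a (scaleC b x) = scaleC (a * b) x"
    and scaleC_one: "scaleC 1 x = x"
    and scaleR_scaleC: "scaleR r x = scaleC (complex_of_real r) x"
    and cinner_commute: "cinner x y = cnj (cinner y x)"
    and cinner_add_left: "cinner (x + y) z = cinner x z + cinner y z"
    and cinner_scaleC_left: "cinner (scaleC a x) y = a * cinner x y"
    and cinner_self_norm: "cinner x x = complex_of_real ((norm x)\<^sup>2)"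

class complex_hilbert_space = complex_inner_space + complete_space

definition bounded_clinear :: "('a::complex_inner_space \<Rightarrow> 'a) \<Rightarrow> bool" where
  "bounded_clinear f \<longleftrightarrow> bounded_linear f \<and> (\<forall>c x. f (scaleC c x) = scaleC c (f x))"

text \<open>A d-tuple is indexed by 0..<d. Degree-k Koszul chains: functions on subsets of
  {..<d}, supported on k-element subsets (the space of k-forms with values in H).\<close>

definition koszul_chain :: "nat \<Rightarrow> nat \<Rightarrow> (nat set \<Rightarrow> 'a::real_vector) set" where
  "koszul_chain d k = {f. \<forall>S. f S \<noteq> 0 \<longrightarrow> S \<subseteq> {..<d} \<and> card S = k}"

definition koszul_bd :: "nat \<Rightarrow> (nat \<Rightarrow> 'a \<Rightarrow> 'a) \<Rightarrow> (nat set \<Rightarrow> 'a::real_vector) \<Rightarrow> nat set \<Rightarrow> 'a" where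
  "koszul_bd d A f S =
     (if S \<subseteq> {..<d}
      then (\<Sum>j\<in>{..<d} - S. ((-1::real) ^ card {i\<in>S. i < j}) *\<^sub>R A j (f (insert j S)))
      else 0)"

definition koszul_exact :: "nat \<Rightarrow> (nat \<Rightarrow> 'a \<Rightarrow> 'a) \<Rightarrow> ('a::real_vector) itself \<Rightarrow> bool" where
  "koszul_exact d A _ \<longleftrightarrow>
     (\<forall>k\<le>d. {f \<in> (koszul_chain d k :: (nat set \<Rightarrow> 'a) set). \<forall>S. koszul_bd d A f S = 0}
              = koszul_bd d A ` koszul_chain d (Suc k))"

definition taylor_spectrum :: "nat \<Rightarrow> (nat \<Rightarrow> 'a \<Rightarrow> 'a::complex_inner_space) \<Rightarrow> (nat \<Rightarrow> complex) set" where
  "taylor_spectrum d T =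
     {z. (\<forall>j\<ge>d. z j = 0) \<and> \<not> koszul_exact d (\<lambda>j x. T j x - scaleC (z j) x) TYPE('a)}"

definition joint_spectral_radius :: "nat \<Rightarrow> (nat \<Rightarrow> 'a \<Rightarrow> 'a::complex_inner_space) \<Rightarrow> real" where
  "joint_spectral_radius d T =
     Sup ((\<lambda>z. sqrt (\<Sum>j<d. (cmod (z j))\<^sup>2)) ` taylor_spectrum d T)"

definition joint_numerical_radius :: "nat \<Rightarrow> (nat \<Rightarrow> 'a \<Rightarrow> 'a::complex_inner_space) \<Rightarrow> real" where
  "joint_numerical_radius d T =
     Sup ((\<lambda>x. sqrt (\<Sum>k<d. (cmod (cinner (T k x) x))\<^sup>2)) ` {x. norm x = 1})"

definition joint_norm :: "nat \<Rightarrow> (nat \<Rightarrow> 'a \<Rightarrow> 'a::complex_inner_space) \<Rightarrow> real" where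
  "joint_norm d T = Sup ((\<lambda>x. sqrt (\<Sum>k<d. (norm (T k x))\<^sup>2)) ` {x. norm x = 1})"

end

(* If z lies in the Taylor spectrum and |z| > w_e(T), then S = sum_j conj(z_j) (T_j - z_j) is
   minus a coercive operator, hence invertible by Lax-Milgram; S commutes with the T_j, so the Koszul
   complex of T - z is contractible, a contradiction.  Thus |z| <= w_e(T) <= ||T|| on the spectrum.
   Joint approximate eigenvalues belong to the Taylor spectrum: exactness at the two top degrees
   makes x |-> (A_j x)_j injective with closed range, hence bounded below by the Baire category theorem.
   They exist for every commuting tuple, so the spectrum is nonempty and (a) forces (b).
   Conversely, if w_e(T) = ||T||, then unit vectors x_n nearly attaining the numerical radius satisfy
   sum_k ||T_k x_n - <T_k x_n, x_n> x_n||^2 = sum_k ||T_k x_n||^2 - sum_k |<T_k x_n, x_n>|^2 -> 0,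
   and a limit point of the (<T_k x_n, x_n>)_k is a point of the spectrum of norm ||T||. *)

theory Submission
  imports Defs "HOL-Analysis.Analysis"
begin

\<comment> \<open>The hard point is that every commuting tuple has an approximate joint eigenvalue.
  Approximate eigenvectors of T_1, ..., T_k form no invariant subspace to which the next operator
  could be restricted. A seminorm, the total defect of the equations solved so far, replaces that
  subspace: commutativity makes the next operator enlarge it by at most a constant factor, so
  finitely many powers do no harm if the initial defect is small enough. The next approximate
  eigenvector is then a weighted piece of an orbit, its phase found by averaging over roots of
  unity; no resolvent or analytic function occurs. The two halves on the spectrum use the Koszul
  complex differently. The upper bound needs exactness in all degrees, obtained from operators B_j
  commuting with the A_j = T_j - z_j and satisfying sum_j B_j A_j = 1. Membership needs only the
  failure of exactness in one of the two top degrees, where the boundary of a vector is its image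
  tuple up to signs. The zero space is a separate case, since all suprema are then taken over the
  empty set.\<close>
subclass (in complex_hilbert_space) banach ..

section \<open>Complex inner product spaces\<close>

lemma scaleC_of_real: "scaleC (complex_of_real r) x = r *\<^sub>R x" for x :: "'a::complex_inner_space"
  by (simp add: scaleR_scaleC)

lemma scaleC_zero_right [simp]: "scaleC a 0 = (0 :: 'a::complex_inner_space)"
  using scaleC_add_right[of a 0 "0::'a"] by simp

lemma scaleC_zero_left [simp]: "scaleC 0 x = (0 :: 'a::complex_inner_space)"
  using scaleC_of_real[of 0 x] by simp

lemma scaleC_minus_right: "scaleC a (- x) = - scaleC a (x :: 'a::complex_inner_space)"
  using scaleC_add_right[of a x "- x"] by (simp add: eq_neg_iff_add_eq_0 add.commute)

lemma scaleC_minus_left: "scaleC (- a) x = - scaleC a (x :: 'a::complex_inner_space)"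
  using scaleC_add_left[of a "- a" x] by (simp add: eq_neg_iff_add_eq_0 add.commute)

lemma scaleC_diff_right: "scaleC a (x - y) = scaleC a x - scaleC a (y :: 'a::complex_inner_space)"
  using scaleC_add_right[of a x "- y"] by (simp add: scaleC_minus_right)

lemma scaleC_diff_left: "scaleC (a - b) x = scaleC a x - scaleC b (x :: 'a::complex_inner_space)"
  using scaleC_add_left[of a "- b" x] by (simp add: scaleC_minus_left)

lemma cinner_zero_left [simp]: "cinner 0 (y :: 'a::complex_inner_space) = 0"
  using cinner_add_left[of 0 0 y] by simp

lemma cinner_add_right: "cinner x (y + z) = cinner x y + cinner x (z :: 'a::complex_inner_space)"
  by (metis cinner_add_left cinner_commute complex_cnj_add)

lemma cinner_zero_right [simp]: "cinner (y :: 'a::complex_inner_space) 0 = 0"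
  using cinner_add_right[of y 0 0] by simp

lemma cinner_scaleC_right: "cinner x (scaleC a y) = cnj a * cinner x (y :: 'a::complex_inner_space)"
  by (metis cinner_commute cinner_scaleC_left complex_cnj_mult)

lemma cinner_minus_left: "cinner (- x) y = - cinner x (y :: 'a::complex_inner_space)"
  using cinner_add_left[of x "- x" y] by (simp add: eq_neg_iff_add_eq_0 add.commute)

lemma cinner_minus_right: "cinner x (- y) = - cinner x (y :: 'a::complex_inner_space)"
  using cinner_add_right[of x y "- y"] by (simp add: eq_neg_iff_add_eq_0 add.commute)

lemma cinner_diff_left: "cinner (x - y) z = cinner x z - cinner y (z :: 'a::complex_inner_space)"
  using cinner_add_left[of x "- y" z] by (simp add: cinner_minus_left)

lemma cinner_diff_right: "cinner x (y - z) = cinner x y - cinner x (z :: 'a::complex_inner_space)"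
  using cinner_add_right[of x y "- z"] by (simp add: cinner_minus_right)

lemma cinner_sum_left: "cinner (\<Sum>i\<in>I. f i) y = (\<Sum>i\<in>I. cinner (f i) (y :: 'a::complex_inner_space))"
  by (induction I rule: infinite_finite_induct) (auto simp: cinner_add_left)

lemma cinner_sum_right: "cinner y (\<Sum>i\<in>I. f i) = (\<Sum>i\<in>I. cinner y (f i :: 'a::complex_inner_space))"
  by (induction I rule: infinite_finite_induct) (auto simp: cinner_add_right)

lemma cinner_scaleR_left: "cinner (r *\<^sub>R x) y = of_real r * cinner x (y :: 'a::complex_inner_space)"
  by (simp add: scaleR_scaleC cinner_scaleC_left)

lemma cinner_scaleR_right: "cinner x (r *\<^sub>R y) = of_real r * cinner x (y :: 'a::complex_inner_space)"
  by (simp add: scaleR_scaleC cinner_scaleC_right)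

lemma Re_cinner_self: "Re (cinner x x) = (norm (x :: 'a::complex_inner_space))\<^sup>2"
  by (simp add: cinner_self_norm)

lemma norm_scaleC [simp]: "norm (scaleC a x) = cmod a * norm (x :: 'a::complex_inner_space)"
proof -
  have "complex_of_real ((norm (scaleC a x))\<^sup>2) = a * cnj a * complex_of_real ((norm x)\<^sup>2)"
    by (simp only: cinner_self_norm[symmetric] cinner_scaleC_left cinner_scaleC_right mult_ac)
  also have "\<dots> = complex_of_real ((cmod a * norm x)\<^sup>2)"
    unfolding power_mult_distrib of_real_mult complex_norm_square[of a] ..
  finally have "(norm (scaleC a x))\<^sup>2 = (cmod a * norm x)\<^sup>2" using of_real_eq_iff by blast
  then show ?thesis by (simp add: power2_eq_iff_nonneg)
qed

lemma norm_diff_sq: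
  "(norm (x - y))\<^sup>2 = (norm x)\<^sup>2 - 2 * Re (cinner y x) + (norm (y :: 'a::complex_inner_space))\<^sup>2"
proof -
  have "Re (cinner x y) = Re (cinner y x)" by (metis cinner_commute complex_cnj(1) complex.sel(1) complex_surj)
  then show ?thesis by (simp add: cinner_diff_left cinner_diff_right flip: Re_cinner_self)
qed

text \<open>Pythagoras: \<open>scaleC (cinner y x) x\<close> is the projection of \<open>y\<close>
  onto the line of \<open>x\<close>. It gives Cauchy-Schwarz and, for y = T_k x, the defect of x as
  an approximate eigenvector.\<close>

lemma norm_diff_projection_sq:
  fixes x y :: "'a::complex_inner_space"
  assumes "norm x = 1"
  shows "(norm (y - scaleC (cinner y x) x))\<^sup>2 = (norm y)\<^sup>2 - (cmod (cinner y x))\<^sup>2"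
proof -
  have "cinner (scaleC (cinner y x) x) y = of_real ((cmod (cinner y x))\<^sup>2)"
    by (metis cinner_commute cinner_scaleC_left complex_norm_square)
  then show ?thesis using assms by (simp add: norm_diff_sq power_mult_distrib)
qed

lemma cmod_cinner_le:
  fixes x y :: "'a::complex_inner_space"
  assumes "norm x = 1"
  shows "cmod (cinner y x) \<le> norm y"
  using norm_diff_projection_sq[OF assms, of y] by (smt (verit) norm_ge_zero power2_le_imp_le zero_le_power2)

text \<open>Solving S x = y is a fixed point problem for x - t (S x - y), which coercivity makes a
  contraction for a suitable t > 0. Injectivity follows from coercivity at a difference.\<close>

lemma lax_milgram:
  fixes S :: "'a::complex_hilbert_space \<Rightarrow> 'a"
  assumes S: "bounded_linear S" and c: "c > 0" and coercive: "\<And>x. c * (norm x)\<^sup>2 \<le> Re (cinner (S x) x)"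
  shows "bij S"
proof -
  interpret S: bounded_linear S by fact
  obtain M where M: "M > 0" "\<And>x. norm (S x) \<le> norm x * M" using S.pos_bounded by blast
  have "inj S"
  proof (rule injI)
    fix x y assume "S x = S y"
    then have "c * (norm (x - y))\<^sup>2 \<le> 0" using coercive[of "x - y"] by (simp add: S.diff)
    then show "x = y" using c by (simp add: mult_le_0_iff)
  qed
  moreover have "\<exists>x. S x = y" for y
  proof -
    \<comment> \<open>Coercivity forces c \<le> M only if there is a nonzero vector; the minimum
      keeps \<open>1 - c'\<^sup>2 / M\<^sup>2\<close> nonnegative in the zero space too.\<close>
    define c' where "c' = min c M"
    have c': "0 < c'" "c' \<le> c" "c' \<le> M" using c M by (auto simp: c'_def)
    \<comment> \<open>This minimises 1 - 2 t c' + t^2 M^2, and the minimum is the square of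
      \<open>k\<close>.\<close>
    define t where "t = c' / M\<^sup>2"
    define k where "k = sqrt (1 - c'\<^sup>2 / M\<^sup>2)"
    have t: "t > 0" using c' M by (simp add: t_def)
    have cM: "c'\<^sup>2 / M\<^sup>2 \<le> 1" "c'\<^sup>2 / M\<^sup>2 > 0" using c' M by (auto simp: power_mono)
    then have k: "0 \<le> k" "k < 1" by (auto simp: k_def)
    have contr: "norm (x - t *\<^sub>R S x) \<le> k * norm x" for x
    proof (rule power2_le_imp_le)
      have "(norm (x - t *\<^sub>R S x))\<^sup>2 = (norm x)\<^sup>2 - 2 * t * Re (cinner (S x) x) + t\<^sup>2 * (norm (S x))\<^sup>2"
        using t by (simp add: norm_diff_sq cinner_scaleR_left power_mult_distrib)
      also have "\<dots> \<le> (norm x)\<^sup>2 - 2 * t * (c' * (norm x)\<^sup>2) + t\<^sup>2 * (norm x * M)\<^sup>2"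
      proof -
        have "c' * (norm x)\<^sup>2 \<le> Re (cinner (S x) x)"
          using coercive[of x] mult_right_mono[OF c'(2), of "(norm x)\<^sup>2"] by simp
        then have "2 * t * (c' * (norm x)\<^sup>2) \<le> 2 * t * Re (cinner (S x) x)" using t by simp
        moreover have "t\<^sup>2 * (norm (S x))\<^sup>2 \<le> t\<^sup>2 * (norm x * M)\<^sup>2"
          by (intro mult_left_mono power_mono M) auto
        ultimately show ?thesis by linarith
      qed
      also have "\<dots> = (1 - c'\<^sup>2 / M\<^sup>2) * (norm x)\<^sup>2"
        using M by (simp add: t_def field_simps power2_eq_square)
      also have "\<dots> = (k * norm x)\<^sup>2" using cM by (simp add: k_def power_mult_distrib)
      finally show "(norm (x - t *\<^sub>R S x))\<^sup>2 \<le> (k * norm x)\<^sup>2" .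
    qed (use k in auto)
    have "\<exists>!x. x - t *\<^sub>R (S x - y) = x"
    proof (rule banach_fix_type[OF k], intro allI)
      fix u v
      have "u - t *\<^sub>R (S u - y) - (v - t *\<^sub>R (S v - y)) = (u - v) - t *\<^sub>R S (u - v)"
        by (simp add: S.diff algebra_simps)
      then show "dist (u - t *\<^sub>R (S u - y)) (v - t *\<^sub>R (S v - y)) \<le> k * dist u v"
        using contr[of "u - v"] by (simp only: dist_norm)
    qed
    then show ?thesis using t by auto
  qed
  ultimately show ?thesis by (metis bij_def surjI)
qed

section \<open>Discrete Fourier analysis on the roots of unity\<close>

lemma sum_root_of_unity:
  assumes "N > 0" "i < N" "j < N"
  shows "(\<Sum>k<N. cis (2 * pi * real k / real N) ^ i * cnj (cis (2 * pi * real k / real N) ^ j)) = (if i = j then of_nat N else 0)"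
proof -
  define z where "z = cis (2 * pi * (real i - real j) / real N)"
  have t: "cis (2 * pi * real k / real N) ^ i * cnj (cis (2 * pi * real k / real N) ^ j) = z ^ k" for k
  proof -
    have "cis (2 * pi * real k / real N) ^ i * cnj (cis (2 * pi * real k / real N) ^ j)
        = cis (real i * (2 * pi * real k / real N) - real j * (2 * pi * real k / real N))"
      by (simp only: complex_cnj_power cis_cnj Complex.DeMoivre cis_mult mult_minus_right diff_conv_add_uminus)
    also have "real i * (2 * pi * real k / real N) - real j * (2 * pi * real k / real N)
        = real k * (2 * pi * (real i - real j) / real N)"
      by (simp add: algebra_simps diff_divide_distrib)
    finally show ?thesis by (simp add: z_def Complex.DeMoivre)
  qed
  have zN: "z ^ N = 1"
  proof -
    have "z ^ N = cis (2 * pi * of_int (int i - int j))" using assms by (simp add: z_def Complex.DeMoivre)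
    also have "\<dots> = 1" by (rule cis_multiple_2pi) simp
    finally show ?thesis .
  qed
  \<comment> \<open>The ratio is 1 only if N divides i - j, impossible for distinct exponents below
    N.\<close>
  have "z \<noteq> 1" if "i \<noteq> j"
  proof
    assume "z = 1"
    then have "cos (2 * pi * (real i - real j) / real N) = 1" by (simp add: z_def complex_eq_iff)
    then obtain n :: int where "2 * pi * (real i - real j) / real N = of_int n * 2 * pi"
      using cos_one_2pi_int by auto
    then have "(2 * pi) * (real i - real j) = (2 * pi) * (of_int n * real N)" using assms by (simp add: field_simps)
    then have "real i - real j = of_int n * real N" by (simp only: mult_cancel_left) simp
    then have e: "int i - int j = n * int N" by (metis (mono_tags, lifting) of_int_diff of_int_eq_iff of_int_mult of_int_of_nat_eq)
    then have "int N dvd int i - int j" by simp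
    then have "int i mod int N = int j mod int N" by (simp add: mod_eq_dvd_iff)
    then show False using that assms by simp
  qed
  then have "(\<Sum>k<N. z ^ k) = (if i = j then of_nat N else 0)"
    using zN by (auto simp: sum_gp_strict z_def)
  then show ?thesis using t by simp
qed

text \<open>Expand the squared norms and sum over k first: orthogonality leaves only the diagonal
  terms.\<close>

lemma parseval_roots_of_unity:
  fixes v :: "nat \<Rightarrow> 'a::complex_inner_space"
  assumes "N > 0"
  shows "(\<Sum>k<N. (norm (\<Sum>i<N. scaleC (cis (2 * pi * real k / real N) ^ i) (v i)))\<^sup>2) = N * (\<Sum>i<N. (norm (v i))\<^sup>2)"
proof -
  define z where "z k = cis (2 * pi * real k / real N)" for k
  have "complex_of_real (\<Sum>k<N. (norm (\<Sum>i<N. scaleC (z k ^ i) (v i)))\<^sup>2)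
      = (\<Sum>k<N. \<Sum>j<N. \<Sum>i<N. cnj (z k ^ j) * (z k ^ i * cinner (v i) (v j)))"
    by (simp only: of_real_sum cinner_self_norm[symmetric] cinner_sum_left cinner_sum_right
        cinner_scaleC_left cinner_scaleC_right sum_distrib_left)
  also have "\<dots> = (\<Sum>j<N. \<Sum>k<N. \<Sum>i<N. cnj (z k ^ j) * (z k ^ i * cinner (v i) (v j)))" by (rule sum.swap)
  also have "\<dots> = (\<Sum>j<N. \<Sum>i<N. \<Sum>k<N. cnj (z k ^ j) * (z k ^ i * cinner (v i) (v j)))"
    by (intro sum.cong refl sum.swap)
  also have "\<dots> = (\<Sum>j<N. \<Sum>i<N. (\<Sum>k<N. z k ^ i * cnj (z k ^ j)) * cinner (v i) (v j))"
    unfolding sum_distrib_right by (simp only: mult_ac)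
  also have "\<dots> = (\<Sum>j<N. \<Sum>i<N. if i = j then of_nat N * cinner (v i) (v j) else 0)"
    using sum_root_of_unity[OF assms] by (intro sum.cong refl) (auto simp: z_def)
  also have "\<dots> = complex_of_real (N * (\<Sum>i<N. (norm (v i))\<^sup>2))"
    by (simp add: cinner_self_norm sum_distrib_left)
  finally show ?thesis unfolding z_def of_real_eq_iff .
qed

section \<open>Approximate eigenvectors\<close>

text \<open>The vector \<open>x\<close> is a tapered piece of the orbit of \<open>e\<close>, and \<open>B x - \<mu> x\<close> involves only the increments
  of the weights.  Parseval, averaged over the \<open>\<mu>\<close> with \<open>\<mu> / r\<close> a root of unity, turns the claim
  into the weighted inequality assumed here.\<close>

lemma power_window:
  fixes B :: "'a::complex_inner_space \<Rightarrow> 'a" and w :: "nat \<Rightarrow> real"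
  assumes add: "\<And>x y. B (x + y) = B x + B y" and scale: "\<And>c x. B (scaleC c x) = scaleC c (B x)"
    and r: "r > 0" and wn: "w n = 0"
    and less: "r\<^sup>2 * (\<Sum>i\<le>n. (((if i = 0 then 0 else w (i - 1)) - w i) * (norm ((B ^^ i) e) / r ^ i))\<^sup>2) + s
       < C * (\<Sum>i\<le>n. (w i * (norm ((B ^^ i) e) / r ^ i))\<^sup>2)"
  obtains \<mu> c x where "cmod \<mu> = r" "\<forall>i. cmod (c i) = \<bar>w i\<bar> / r ^ i" "x = (\<Sum>i\<le>n. scaleC (c i) ((B ^^ i) e))"
    "(norm (B x - scaleC \<mu> x))\<^sup>2 + s < C * (norm x)\<^sup>2"
proof -
  define w' where "w' i = (if i = 0 then 0 else w (i - 1))" for i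
  define N where "N = Suc n"
  define z where "z k = cis (2 * pi * real k / real N)" for k
  define v where "v i = (w i / r ^ i) *\<^sub>R ((B ^^ i) e)" for i
  define u where "u i = ((w' i - w i) / r ^ i) *\<^sub>R ((B ^^ i) e)" for i
  define x where "x k = (\<Sum>i<N. scaleC (z k ^ i) (v i))" for k
  \<comment> \<open>With the conjugate phase, B x and \<mu> x carry the same factor z_k^i at the
    vector \<open>(B ^^ Suc i) e\<close>, so their difference there sees only the increment of the
    weights.\<close>
  define \<mu> where "\<mu> k = of_real r * cnj (z k)" for k
  have B0: "B 0 = 0" using scale[of 0 0] by simp
  have Bsum: "B (\<Sum>i\<in>I. f i) = (\<Sum>i\<in>I. B (f i))" for I and f :: "nat \<Rightarrow> 'a"
    by (induction I rule: infinite_finite_induct) (auto simp: B0 add)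
  have zz: "cnj (z k) * z k = 1" for k
    by (simp add: z_def cis_cnj cis_mult)
  have n\<mu>: "cmod (\<mu> k) = r" for k using r by (simp add: \<mu>_def norm_mult z_def)
  have y: "B (x k) - scaleC (\<mu> k) (x k) = scaleC (\<mu> k) (\<Sum>i<N. scaleC (z k ^ i) (u i))" for k
  proof -
    have *: "scaleC (\<mu> k) (scaleC (z k ^ Suc i) ((w i / r ^ Suc i) *\<^sub>R b)) = scaleC (z k ^ i) ((w i / r ^ i) *\<^sub>R b)" for i b
    proof -
      have "\<mu> k * (z k ^ Suc i * complex_of_real (w i / r ^ Suc i)) = (cnj (z k) * z k) * (z k ^ i * complex_of_real (w i / r ^ i))"
        using r by (simp add: \<mu>_def field_simps)
      then show ?thesis by (simp add: scaleR_scaleC scaleC_scaleC zz)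
    qed
    \<comment> \<open>The sum stops before \<open>n\<close> because \<open>w n = 0\<close>, so
      \<open>B\<close> does not push the orbit out of the window.\<close>
    have "B (x k) = (\<Sum>i<n. scaleC (z k ^ i) ((w i / r ^ i) *\<^sub>R ((B ^^ Suc i) e)))"
      by (simp add: x_def N_def v_def wn Bsum scaleR_scaleC scale)
    also have "\<dots> = scaleC (\<mu> k) (\<Sum>i<N. scaleC (z k ^ i) ((w' i / r ^ i) *\<^sub>R ((B ^^ i) e)))"
    proof -
      have sum: "scaleC (\<mu> k) (\<Sum>i\<in>I. f i) = (\<Sum>i\<in>I. scaleC (\<mu> k) (f i))" for I and f :: "nat \<Rightarrow> 'a"
        by (induction I rule: infinite_finite_induct) (auto simp: scaleC_add_right)
      show ?thesis unfolding N_def sum.lessThan_Suc_shift sum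
        by (simp add: w'_def scaleC_add_right sum * del: power_Suc funpow.simps)
    qed
    finally have "B (x k) = scaleC (\<mu> k) (\<Sum>i<N. scaleC (z k ^ i) ((w' i / r ^ i) *\<^sub>R ((B ^^ i) e)))" .
    moreover have "scaleC (z k ^ i) (u i) = scaleC (z k ^ i) ((w' i / r ^ i) *\<^sub>R ((B ^^ i) e)) - scaleC (z k ^ i) (v i)" for i
      by (simp add: u_def v_def diff_divide_distrib scaleR_diff_left scaleC_diff_right)
    ultimately show ?thesis
      by (simp add: x_def sum_subtractf scaleC_diff_right)
  qed
  have ab: "(\<Sum>i<N. (norm (u i))\<^sup>2) = (\<Sum>i\<le>n. ((w' i - w i) * (norm ((B ^^ i) e) / r ^ i))\<^sup>2)"
    "(\<Sum>i<N. (norm (v i))\<^sup>2) = (\<Sum>i\<le>n. (w i * (norm ((B ^^ i) e) / r ^ i))\<^sup>2)"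
    unfolding N_def lessThan_Suc_atMost u_def v_def using r
    by (simp_all add: power_mult_distrib power_divide)
  \<comment> \<open>If every phase failed, summing over k and applying Parseval to both sides would
    contradict \<open>less\<close>. The constant \<open>s\<close> is carried along and later bounds
    the chosen vector from below.\<close>
  have "\<exists>k<N. (norm (B (x k) - scaleC (\<mu> k) (x k)))\<^sup>2 + s < C * (norm (x k))\<^sup>2"
  proof (rule ccontr)
    assume "\<not> ?thesis"
    then have "(\<Sum>k<N. C * (norm (x k))\<^sup>2) \<le> (\<Sum>k<N. (norm (B (x k) - scaleC (\<mu> k) (x k)))\<^sup>2 + s)"
      by (intro sum_mono) (meson lessThan_iff linorder_not_less)
    also have "(\<Sum>k<N. (norm (B (x k) - scaleC (\<mu> k) (x k)))\<^sup>2 + s)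
       = r\<^sup>2 * (\<Sum>k<N. (norm (\<Sum>i<N. scaleC (z k ^ i) (u i)))\<^sup>2) + N * s"
      by (simp add: y sum.distrib power_mult_distrib n\<mu> sum_distrib_left)
    also have "(\<Sum>k<N. (norm (\<Sum>i<N. scaleC (z k ^ i) (u i)))\<^sup>2) = N * (\<Sum>i<N. (norm (u i))\<^sup>2)"
      unfolding z_def by (rule parseval_roots_of_unity) (simp add: N_def)
    also have "(\<Sum>k<N. C * (norm (x k))\<^sup>2) = C * (N * (\<Sum>i<N. (norm (v i))\<^sup>2))"
      unfolding x_def z_def sum_distrib_left[symmetric] by (subst parseval_roots_of_unity) (simp_all add: N_def)
    finally have "real N * (C * (\<Sum>i<N. (norm (v i))\<^sup>2)) \<le> real N * (r\<^sup>2 * (\<Sum>i<N. (norm (u i))\<^sup>2) + s)"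
      by (simp add: algebra_simps)
    then have "C * (\<Sum>i<N. (norm (v i))\<^sup>2) \<le> r\<^sup>2 * (\<Sum>i<N. (norm (u i))\<^sup>2) + s"
      by (rule mult_left_le_imp_le) (simp add: N_def)
    then show False using less unfolding ab w'_def by simp
  qed
  then obtain k where k: "(norm (B (x k) - scaleC (\<mu> k) (x k)))\<^sup>2 + s < C * (norm (x k))\<^sup>2" by blast
  show thesis
  proof (rule that[of "\<mu> k" "\<lambda>i. z k ^ i * of_real (w i / r ^ i)" "x k"])
    show "cmod (\<mu> k) = r" by (rule n\<mu>)
    show "\<forall>i. cmod (z k ^ i * of_real (w i / r ^ i)) = \<bar>w i\<bar> / r ^ i"
      using r by (simp add: norm_mult z_def norm_power norm_divide)
    show "x k = (\<Sum>i\<le>n. scaleC (z k ^ i * of_real (w i / r ^ i)) ((B ^^ i) e))"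
      unfolding x_def v_def N_def lessThan_Suc_atMost scaleR_scaleC scaleC_scaleC ..
  qed (rule k)
qed

text \<open>The seminorm \<open>g\<close> measures the defect of the approximate eigenvector equations that are already
  solved.  With \<open>\<rho>\<close> the spectral radius of \<open>B\<close> on vectors of negligible \<open>g\<close>, the powers of \<open>B\<close> at a
  suitable \<open>e\<close> grow faster than \<open>(\<rho> p)^i\<close> up to \<open>m\<close> and slower than \<open>(\<rho> / p)^i\<close> from there to \<open>n\<close>,
  so the window \<open>q ^ \<bar>i - m\<bar>\<close>, with \<open>q = p\<^sup>2\<close>, makes both boundary terms small.\<close>

lemma approximate_eigenvector:
  fixes B :: "'a::complex_inner_space \<Rightarrow> 'a" and g :: "'a \<Rightarrow> real"
  assumes add: "\<And>x y. B (x + y) = B x + B y" and scale: "\<And>c x. B (scaleC c x) = scaleC c (B x)"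
    and M: "M \<ge> 1" "\<And>x. norm (B x) \<le> M * norm x" and expand: "\<And>x. norm x \<le> norm (B x)"
    and gadd: "\<And>x y. g (x + y) \<le> g x + g y" and gscale: "\<And>c x. g (scaleC c x) = cmod c * g x"
    and gB: "\<And>x. g (B x) \<le> M * g x"
    and ex: "\<And>\<delta>. \<delta> > 0 \<Longrightarrow> \<exists>x. norm x = 1 \<and> g x \<le> \<delta>"
    and \<epsilon>: "\<epsilon> > 0"
  shows "\<exists>\<mu> x. cmod \<mu> \<le> M \<and> norm x = 1 \<and> g x \<le> \<epsilon> \<and> norm (B x - scaleC \<mu> x) \<le> \<epsilon>"
proof -
  have B0: "B 0 = 0" using scale[of 0 0] by simp
  have Bn0: "(B ^^ i) 0 = 0" for i by (induction i) (auto simp: B0)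
  have Bns: "(B ^^ i) (scaleC c x) = scaleC c ((B ^^ i) x)" for i c x by (induction i) (auto simp: scale)
  have g0: "g 0 = 0" using gscale[of 0 0] by simp
  have gpos: "0 \<le> g x" for x
    using gadd[of x "scaleC (-1) x"] gscale[of "-1" x] by (simp add: scaleC_minus_left scaleC_one g0)
  have gsum: "g (\<Sum>i\<in>I. f i) \<le> (\<Sum>i\<in>I. g (f i))" for I and f :: "nat \<Rightarrow> 'a"
  proof (induction I rule: infinite_finite_induct)
    case (insert i I)
    then show ?case using gadd[of "f i" "sum f I"] by simp
  qed (auto simp: g0)
  have up: "norm ((B ^^ i) x) \<le> M ^ i * norm x" for i x
  proof (induction i)
    case (Suc i)
    have "norm ((B ^^ Suc i) x) \<le> M * norm ((B ^^ i) x)" using M(2) by simp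
    also have "\<dots> \<le> M * (M ^ i * norm x)" using Suc M(1) by (intro mult_left_mono) auto
    finally show ?case by simp
  qed simp
  have down: "norm x \<le> norm ((B ^^ i) x)" for i x
  proof (induction i)
    case (Suc i)
    then show ?case using expand[of "(B ^^ i) x"] by simp
  qed simp
  have gup: "g ((B ^^ i) x) \<le> M ^ i * g x" for i x
  proof (induction i)
    case (Suc i)
    have "g ((B ^^ Suc i) x) \<le> M * g ((B ^^ i) x)" using gB by simp
    also have "\<dots> \<le> M * (M ^ i * g x)" using Suc M(1) by (intro mult_left_mono) auto
    finally show ?case by simp
  qed simp

  \<comment> \<open>The quantifiers serve both directions. Membership of r gives slow growth along
    arbitrarily long powers, for all vectors of small relative defect; failure for r > 0 gives, for
    every long power and every \<delta>, a vector that grows faster.\<close>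
  define G where "G = {r. 0 < r \<and> (\<forall>L. \<exists>l\<ge>L. \<exists>\<delta>>0. \<forall>y. g y \<le> \<delta> * norm y \<longrightarrow> norm ((B ^^ l) y) \<le> r ^ l * norm y)}"
  define \<rho> where "\<rho> = Inf G"
  have "M \<in> G" unfolding G_def using M(1) up by (auto intro!: exI[of _ "1::real"])
  \<comment> \<open>\<open>B\<close> never shrinks a vector, and \<open>ex\<close> supplies vectors
    to which the condition in \<open>G\<close> applies.\<close>
  have G1: "1 \<le> r" if "r \<in> G" for r
  proof (rule ccontr)
    assume "\<not> 1 \<le> r"
    then have r: "0 < r" "r < 1" using that by (auto simp: G_def)
    obtain l \<delta> where l: "l \<ge> 1" "\<delta> > 0" "\<forall>y. g y \<le> \<delta> * norm y \<longrightarrow> norm ((B ^^ l) y) \<le> r ^ l * norm y"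
      using \<open>r \<in> G\<close> unfolding G_def by blast
    obtain y where y: "norm y = 1" "g y \<le> \<delta>" using ex[OF l(2)] by blast
    have "1 \<le> norm ((B ^^ l) y)" using down[of y l] y(1) by simp
    also have "\<dots> \<le> r ^ l * norm y" using l(3)[rule_format, of y] y by simp
    finally have "1 \<le> r ^ l" using y(1) by simp
    moreover have "r ^ l < 1" using power_decreasing[of 1 l r] r l(1) by simp
    ultimately show False by simp
  qed
  have bdd: "bdd_below G" using G1 by (meson bdd_belowI)
  have \<rho>: "1 \<le> \<rho>" "\<rho> \<le> M"
    unfolding \<rho>_def using \<open>M \<in> G\<close> G1 bdd by (auto intro: cInf_greatest cInf_lower)

  \<comment> \<open>Increments inside the window cost at most \<theta> times the weight, and \<rho>
    \<le> M turns \<theta> into \<eta>. The interior and the two ends contribute 3 \<eta>^2 W, the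
    extra term below another \<eta>^2 W, and 4 < 9 = (\<epsilon> / \<eta>)^2.\<close>
  define \<eta> where "\<eta> = \<epsilon> / 3"
  define \<theta> where "\<theta> = \<eta> / M"
  define q where "q = 1 / (1 + \<theta>)"
  \<comment> \<open>The weights decay like q^j = p^j p^j: one factor pays for the growth rates
    \<rho> p and \<rho> / p, the other drops below \<theta> once j \<ge> K.\<close>
  define p where "p = sqrt q"
  have \<eta>: "\<eta> > 0" and \<theta>: "\<theta> > 0" using \<epsilon> M by (auto simp: \<eta>_def \<theta>_def)
  have q: "0 < q" "q < 1" "1 / q - 1 = \<theta>" using \<theta> by (auto simp: q_def)
  have p: "0 < p" "p < 1" "p * p = q" using q by (auto simp: p_def)
  obtain K where K: "p ^ K < \<theta>" using real_arch_pow_inv[OF \<theta>] p by blast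
  have K': "p ^ j \<le> \<theta>" if "j \<ge> K" for j
    using power_decreasing[OF that, of p] K p by linarith
  have "\<rho> * p \<notin> G"
  proof
    assume "\<rho> * p \<in> G"
    then have "\<rho> \<le> \<rho> * p" using bdd by (simp add: \<rho>_def cInf_lower)
    then show False using p \<rho> by (simp add: mult_le_cancel_left1)
  qed
  then obtain L where L: "\<And>l \<delta>. L \<le> l \<Longrightarrow> 0 < \<delta> \<Longrightarrow> \<exists>y. g y \<le> \<delta> * norm y \<and> (\<rho> * p) ^ l * norm y < norm ((B ^^ l) y)"
  proof -
    have "\<not> (\<forall>L. \<exists>l\<ge>L. \<exists>\<delta>>0. \<forall>y. g y \<le> \<delta> * norm y \<longrightarrow> norm ((B ^^ l) y) \<le> (\<rho> * p) ^ l * norm y)"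
      using \<open>\<rho> * p \<notin> G\<close> p \<rho> by (simp add: G_def)
    then show thesis using that by (meson not_le)
  qed
  define m where "m = max L K"
  have "\<rho> < \<rho> / p" using p \<rho> by (simp add: field_simps)
  then obtain s where s: "s \<in> G" "s < \<rho> / p"
    unfolding \<rho>_def using \<open>M \<in> G\<close> by (metis cInf_lessD empty_iff)
  \<comment> \<open>The last nonzero weight is q^(l - 1) = p^(l - 2) p^l, whence K + 2.\<close>
  then obtain l \<delta>0 where l: "l \<ge> K + 2" and \<delta>0: "\<delta>0 > 0"
    and ls: "\<And>y. g y \<le> \<delta>0 * norm y \<Longrightarrow> norm ((B ^^ l) y) \<le> s ^ l * norm y"
    unfolding G_def by blast
  define n where "n = m + l"
  \<comment> \<open>The first bound keeps the defect of \<open>(B ^^ m) e\<close> below \<delta>0,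
    so that \<open>ls\<close> applies to it; the second keeps the defect of the whole window, at
    most (n + 1) M^n \<delta>, below \<eta> p^m.\<close>
  define \<delta> where "\<delta> = min (\<delta>0 / M ^ m) (\<eta> * p ^ m / (Suc n * M ^ n))"
  have "\<delta> > 0" using \<delta>0 \<eta> p M by (simp add: \<delta>_def)
  then obtain y where y: "g y \<le> \<delta> * norm y" "(\<rho> * p) ^ m * norm y < norm ((B ^^ m) y)"
    using L[of m \<delta>] by (auto simp: m_def)
  then have "y \<noteq> 0" using Bn0[of m] by auto
  define e where "e = scaleC (of_real (1 / norm y)) y"
  have e1: "norm e = 1" using \<open>y \<noteq> 0\<close> by (simp add: e_def norm_divide)
  have ge: "g e \<le> \<delta>" using y(1) \<open>y \<noteq> 0\<close> by (simp add: e_def gscale norm_divide field_simps)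
  define a where "a i = norm ((B ^^ i) e) / \<rho> ^ i" for i
  have apos: "0 \<le> a i" for i using \<rho> by (simp add: a_def)
  have a0: "a 0 = 1" by (simp add: a_def e1)
  have am: "p ^ m \<le> a m"
    using y(2) \<open>y \<noteq> 0\<close> \<rho> by (simp add: a_def e_def Bns norm_divide field_simps)
  have an: "p ^ l * a n \<le> a m"
  proof -
    have "g ((B ^^ m) e) \<le> M ^ m * \<delta>" using gup[of m e] ge M(1) by (meson mult_left_mono order_trans zero_le_power zero_le_one)
    also have "\<dots> \<le> \<delta>0" using M(1) by (simp add: \<delta>_def min_def field_simps)
    also have "\<dots> \<le> \<delta>0 * norm ((B ^^ m) e)" using down[of e m] \<delta>0 e1 by simp
    finally have "norm ((B ^^ l) ((B ^^ m) e)) \<le> s ^ l * norm ((B ^^ m) e)" by (rule ls)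
    then have "norm ((B ^^ n) e) \<le> s ^ l * norm ((B ^^ m) e)" by (simp add: n_def add.commute[of m] funpow_add)
    also have "\<dots> \<le> (\<rho> / p) ^ l * norm ((B ^^ m) e)"
      using s by (intro mult_right_mono power_mono) (auto simp: G_def)
    finally show ?thesis using \<rho> p by (simp add: a_def n_def power_add field_simps)
  qed

  define w where "w i = (if n \<le> i then 0 else if i \<le> m then q ^ (m - i) else q ^ (i - m))" for i
  define w' where "w' i = (if i = 0 then 0 else w (i - 1))" for i
  have mn: "m < n" using l by (simp add: n_def)
  have w01: "0 \<le> w i" "w i \<le> 1" for i using q by (auto simp: w_def power_le_one)
  define W where "W = (\<Sum>i\<le>n. (w i * a i)\<^sup>2)"
  have "w m = 1" using mn by (simp add: w_def)
  have W: "(a m)\<^sup>2 \<le> W"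
    using member_le_sum[of m "{..n}" "\<lambda>i. (w i * a i)\<^sup>2"] mn \<open>w m = 1\<close> by (simp add: W_def)
  have am_pos: "0 < a m" using am p by (meson less_le_trans zero_less_power)
  then have Wpos: "0 < W" using W by (smt (verit) zero_less_power)
  \<comment> \<open>As \<open>w' 0 = 0\<close> and \<open>w n = 0\<close>, the increments at the two
    ends are, up to sign, the full weights \<open>w 0\<close> and \<open>w (n - 1)\<close>.\<close>
  have w0: "w 0 * a 0 \<le> \<theta> * a m"
  proof -
    have "w 0 * a 0 = p ^ m * p ^ m" using mn a0 p(3) by (simp add: w_def flip: power_mult_distrib)
    also have "\<dots> \<le> \<theta> * a m" using am K'[of m] p \<theta> by (intro mult_mono) (auto simp: m_def)
    finally show ?thesis .
  qed
  have wn: "w (n - 1) * a n \<le> \<theta> * a m"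
  proof -
    have "w (n - 1) = q ^ (l - 1)" using l by (auto simp: w_def n_def)
    also have "\<dots> = p ^ (l - 1) * p ^ (l - 1)" using p(3) by (simp flip: power_mult_distrib)
    also have "\<dots> = p ^ (l - 2) * p ^ l" using l by (simp flip: power_add) (rule arg_cong[of _ _ "power p"], simp)
    finally have "w (n - 1) * a n = p ^ (l - 2) * (p ^ l * a n)" by simp
    also have "\<dots> \<le> \<theta> * a m" using an K'[of "l - 2"] l p \<theta> apos by (intro mult_mono) auto
    finally show ?thesis .
  qed
  have inner: "\<bar>w' i - w i\<bar> \<le> \<theta> * w i" if "0 < i" "i < n" for i
  proof (cases "i \<le> m")
    case True
    have "m - (i - 1) = Suc (m - i)" "i - 1 \<le> m" "\<not> n \<le> i - 1" using True that by linarith+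
    then have "w' i = q * w i" using that True by (simp add: w_def w'_def)
    then have "w' i - w i = - ((1 - q) * w i)" by (simp add: algebra_simps)
    then have "\<bar>w' i - w i\<bar> = (1 - q) * w i" using q w01[of i] by (simp add: abs_mult)
    moreover have "1 - q \<le> \<theta>" using q by (simp add: q_def field_simps)
    ultimately show ?thesis using w01[of i] by (simp add: mult_right_mono)
  next
    case False
    then have "i - m = Suc (i - 1 - m)" by simp
    then have "w i = q * w' i" using that False by (auto simp: w_def w'_def)
    then have "w' i - w i = \<theta> * w i" using q by (simp flip: q(3)) (simp add: field_simps)
    then show ?thesis using w01[of i] \<theta> by simp
  qed
  have summand: "((w' i - w i) * a i)\<^sup>2 \<le> \<theta>\<^sup>2 * (w i * a i)\<^sup>2 + (if i = 0 then \<theta>\<^sup>2 * (a m)\<^sup>2 else 0) + (if i = n then \<theta>\<^sup>2 * (a m)\<^sup>2 else 0)"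
    if i_le: "i \<le> n" for i
  proof -
    consider "i = 0" | "i = n" "i \<noteq> 0" | "0 < i" "i < n" using i_le by linarith
    then show ?thesis
    proof cases
      case 1
      have "(w 0 * a 0)\<^sup>2 \<le> (\<theta> * a m)\<^sup>2" using w0 w01 apos by (intro power_mono) auto
      then show ?thesis using 1 mn by (simp add: w'_def power_mult_distrib add_increasing)
    next
      case 2
      have "(w (n - 1) * a n)\<^sup>2 \<le> (\<theta> * a m)\<^sup>2" using wn w01 apos by (intro power_mono) auto
      then show ?thesis using 2 mn by (simp add: w'_def power_mult_distrib w_def[of n])
    next
      case 3
      have "\<bar>(w' i - w i) * a i\<bar> \<le> \<theta> * (w i * a i)"
        using mult_right_mono[OF inner[OF 3] apos[of i]] apos[of i] by (simp add: abs_mult mult.assoc)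
      then have "((w' i - w i) * a i)\<^sup>2 \<le> (\<theta> * (w i * a i))\<^sup>2" by (metis abs_ge_zero power2_abs power_mono)
      then show ?thesis using 3 by (simp add: power_mult_distrib)
    qed
  qed
  have "(\<Sum>i\<le>n. ((w' i - w i) * a i)\<^sup>2) \<le> \<theta>\<^sup>2 * W + \<theta>\<^sup>2 * (a m)\<^sup>2 + \<theta>\<^sup>2 * (a m)\<^sup>2"
  proof -
    have "(\<Sum>i\<le>n. ((w' i - w i) * a i)\<^sup>2) \<le> (\<Sum>i\<le>n. \<theta>\<^sup>2 * (w i * a i)\<^sup>2 + (if i = 0 then \<theta>\<^sup>2 * (a m)\<^sup>2 else 0) + (if i = n then \<theta>\<^sup>2 * (a m)\<^sup>2 else 0))"
      by (rule sum_mono) (rule summand, simp)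
    also have "\<dots> = \<theta>\<^sup>2 * W + \<theta>\<^sup>2 * (a m)\<^sup>2 + \<theta>\<^sup>2 * (a m)\<^sup>2"
      unfolding sum.distrib by (simp add: W_def sum_distrib_left)
    finally show ?thesis .
  qed
  also have "\<dots> \<le> 3 * \<theta>\<^sup>2 * W" using mult_left_mono[OF W, of "\<theta>\<^sup>2"] by (simp add: mult.commute)
  finally have "\<rho>\<^sup>2 * (\<Sum>i\<le>n. ((w' i - w i) * a i)\<^sup>2) \<le> M\<^sup>2 * (3 * \<theta>\<^sup>2 * W)"
    using \<rho> by (intro mult_mono power_mono) (auto intro!: sum_nonneg)
  also have "M\<^sup>2 * (3 * \<theta>\<^sup>2 * W) = 3 * \<eta>\<^sup>2 * W" using M(1) by (simp add: \<theta>_def power_divide)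
  \<comment> \<open>The added square is the \<open>s\<close> of \<open>power_window\<close>. It
    excludes that cancellation makes x small: it yields \<eta> a_m \<le> \<epsilon> |x|, while g x
    \<le> \<eta> a_m by the choice of \<delta>.\<close>
  finally have "\<rho>\<^sup>2 * (\<Sum>i\<le>n. ((w' i - w i) * a i)\<^sup>2) + (\<eta> * a m)\<^sup>2 \<le> 4 * \<eta>\<^sup>2 * W"
    using mult_left_mono[OF W, of "\<eta>\<^sup>2"] by (simp add: power_mult_distrib)
  also have "\<dots> < 9 * \<eta>\<^sup>2 * W" using Wpos \<eta> by simp
  finally have lt: "\<rho>\<^sup>2 * (\<Sum>i\<le>n. ((w' i - w i) * a i)\<^sup>2) + (\<eta> * a m)\<^sup>2 < 9 * \<eta>\<^sup>2 * W" .
  have "0 < \<rho>" "w n = 0" using \<rho> by (auto simp: w_def)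
  obtain \<mu> c x where \<mu>: "cmod \<mu> = \<rho>" and c: "\<forall>i. cmod (c i) = \<bar>w i\<bar> / \<rho> ^ i"
    and x: "x = (\<Sum>i\<le>n. scaleC (c i) ((B ^^ i) e))"
    and less: "(norm (B x - scaleC \<mu> x))\<^sup>2 + (\<eta> * (norm ((B ^^ m) e) / \<rho> ^ m))\<^sup>2 < 9 * \<eta>\<^sup>2 * (norm x)\<^sup>2"
    by (rule power_window[OF add scale \<open>0 < \<rho>\<close> \<open>w n = 0\<close> lt[unfolded w'_def a_def W_def]]) (rule that)
  have \<eta>\<epsilon>: "9 * \<eta>\<^sup>2 * (norm x)\<^sup>2 = (\<epsilon> * norm x)\<^sup>2"
    by (simp add: \<eta>_def power_mult_distrib power_divide)
  have "0 \<le> (norm (B x - scaleC \<mu> x))\<^sup>2" "0 \<le> (\<eta> * a m)\<^sup>2" by simp_all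
  then have less1: "(norm (B x - scaleC \<mu> x))\<^sup>2 < (\<epsilon> * norm x)\<^sup>2" and less2: "(\<eta> * a m)\<^sup>2 < (\<epsilon> * norm x)\<^sup>2"
    using less unfolding \<eta>\<epsilon> a_def by linarith+
  have x0: "norm x > 0" using less1 by auto
  have "(norm (B x - scaleC \<mu> x))\<^sup>2 \<le> (\<epsilon> * norm x)\<^sup>2" using less1 by simp
  then have 1: "norm (B x - scaleC \<mu> x) \<le> \<epsilon> * norm x" by (rule power2_le_imp_le) (use \<epsilon> in simp)
  have "g x \<le> (\<Sum>i\<le>n. g (scaleC (c i) ((B ^^ i) e)))" unfolding x by (rule gsum)
  also have "\<dots> \<le> (\<Sum>i\<le>n. M ^ n * \<delta>)"
  proof (rule sum_mono)
    fix i assume "i \<in> {..n}"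
    have "1 \<le> \<rho> ^ i" using \<rho> by simp
    then have "\<bar>w i\<bar> / \<rho> ^ i \<le> 1" using w01[of i] by (simp add: divide_le_eq)
    then have "cmod (c i) \<le> 1" using c by simp
    moreover have "g ((B ^^ i) e) \<le> M ^ i * \<delta>"
      by (rule order_trans[OF gup mult_left_mono[OF ge]]) (use M(1) in simp)
    ultimately have "cmod (c i) * g ((B ^^ i) e) \<le> 1 * (M ^ i * \<delta>)"
      using gpos by (intro mult_mono) auto
    also have "\<dots> \<le> M ^ n * \<delta>" using \<open>i \<in> {..n}\<close> M(1) \<open>\<delta> > 0\<close> by (simp add: power_increasing)
    finally show "g (scaleC (c i) ((B ^^ i) e)) \<le> M ^ n * \<delta>" by (simp add: gscale)
  qed
  also have "\<dots> = (Suc n * M ^ n) * \<delta>" by simp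
  also have "\<dots> \<le> (Suc n * M ^ n) * (\<eta> * p ^ m / (Suc n * M ^ n))"
    using M(1) by (intro mult_left_mono) (auto simp: \<delta>_def)
  also have "\<dots> = \<eta> * p ^ m" using M(1) by simp
  also have "\<dots> \<le> \<eta> * a m" using am \<eta> by simp
  finally have "g x \<le> \<eta> * a m" .
  moreover have "(\<eta> * a m)\<^sup>2 \<le> (\<epsilon> * norm x)\<^sup>2"
    using less2 by simp
  then have "\<eta> * a m \<le> \<epsilon> * norm x" by (rule power2_le_imp_le) (use \<epsilon> in simp)
  ultimately have 2: "g x \<le> \<epsilon> * norm x" by linarith
  define b where "b = complex_of_real (1 / norm x)"
  have b: "cmod b = 1 / norm x" by (simp add: b_def norm_divide)
  have "B (scaleC b x) - scaleC \<mu> (scaleC b x) = scaleC b (B x - scaleC \<mu> x)"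
    by (simp add: scale scaleC_diff_right scaleC_scaleC mult.commute)
  then have "norm (B (scaleC b x) - scaleC \<mu> (scaleC b x)) \<le> \<epsilon>"
    using 1 x0 by (simp add: b divide_le_eq)
  moreover have "g (scaleC b x) \<le> \<epsilon>" using 2 x0 by (simp add: gscale b divide_le_eq)
  moreover have "norm (scaleC b x) = 1" using x0 by (simp add: b)
  ultimately show ?thesis using \<mu> \<rho> by blast
qed

section \<open>The Koszul complex\<close>

lemma koszul_bd_chain:
  assumes "f \<in> koszul_chain d (Suc k)" "\<And>j. j < d \<Longrightarrow> A j 0 = 0"
  shows "koszul_bd d A f \<in> koszul_chain d k"
proof -
  have "S \<subseteq> {..<d} \<and> card S = k" if "koszul_bd d A f S \<noteq> 0" for S
  proof -
    have S: "S \<subseteq> {..<d}" using that by (auto simp: koszul_bd_def split: if_splits)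
    with that obtain j where "j \<in> {..<d} - S" "A j (f (insert j S)) \<noteq> 0"
      by (force simp: koszul_bd_def intro: sum.neutral)
    then have "j < d" "j \<notin> S" "f (insert j S) \<noteq> 0" using assms(2) by auto
    then have "card (insert j S) = Suc k" using assms(1) by (auto simp: koszul_chain_def)
    then show ?thesis using S \<open>j \<notin> S\<close> finite_subset[OF S] by simp
  qed
  then show ?thesis by (auto simp: koszul_chain_def)
qed

definition koszul_sign :: "nat \<Rightarrow> nat set \<Rightarrow> real" where
  "koszul_sign j S = (-1) ^ card {i\<in>S. i < j}"

lemma koszul_sign_sq: "koszul_sign j S * koszul_sign j S = 1"
  by (simp add: koszul_sign_def flip: power_mult_distrib)

lemma koszul_sign_insert:
  assumes "finite S" "i \<notin> S"
  shows "koszul_sign j (insert i S) = (if i < j then - koszul_sign j S else koszul_sign j S)"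
proof -
  have "{k \<in> insert i S. k < j} = (if i < j then insert i {k\<in>S. k < j} else {k\<in>S. k < j})" by auto
  then show ?thesis using assms by (simp add: koszul_sign_def)
qed

lemma koszul_bd_sign:
  "koszul_bd d A f S = (if S \<subseteq> {..<d} then \<Sum>j\<in>{..<d} - S. koszul_sign j S *\<^sub>R A j (f (insert j S)) else 0)"
  by (simp add: koszul_bd_def koszul_sign_def)

text \<open>The value at S is a sum over ordered pairs of distinct indices outside S. Exchanging the
  pair flips the sign and, by commutativity, nothing else, so the sum is its own negative.\<close>

lemma koszul_bd_bd:
  fixes A :: "nat \<Rightarrow> 'a::real_vector \<Rightarrow> 'a"
  assumes lin: "\<And>j. j < d \<Longrightarrow> linear (A j)"
    and comm: "\<And>i j x. i < d \<Longrightarrow> j < d \<Longrightarrow> A i (A j x) = A j (A i x)"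
  shows "koszul_bd d A (koszul_bd d A f) S = 0"
proof (cases "S \<subseteq> {..<d}")
  case True
  then have fin: "finite S" using finite_subset by blast
  define R where "R = {..<d} - S"
  define F where "F j i = (koszul_sign j S * koszul_sign i (insert j S)) *\<^sub>R A j (A i (f (insert i (insert j S))))" for j i
  have eq: "koszul_bd d A (koszul_bd d A f) S = (\<Sum>j\<in>R. \<Sum>i\<in>R - {j}. F j i)"
  proof -
    have "koszul_bd d A (koszul_bd d A f) S
        = (\<Sum>j\<in>R. koszul_sign j S *\<^sub>R A j (\<Sum>i\<in>{..<d} - insert j S. koszul_sign i (insert j S) *\<^sub>R A i (f (insert i (insert j S)))))"
      using True unfolding koszul_bd_sign[of d A "koszul_bd d A f"]
      by (simp add: R_def) (rule sum.cong, auto simp: koszul_bd_sign)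
    also have "\<dots> = (\<Sum>j\<in>R. \<Sum>i\<in>R - {j}. F j i)"
    proof (rule sum.cong[OF refl])
      fix j assume j: "j \<in> R"
      then have "linear (A j)" using lin by (simp add: R_def)
      moreover have "{..<d} - insert j S = R - {j}" by (auto simp: R_def)
      ultimately show "koszul_sign j S *\<^sub>R A j (\<Sum>i\<in>{..<d} - insert j S. koszul_sign i (insert j S) *\<^sub>R A i (f (insert i (insert j S))))
         = (\<Sum>i\<in>R - {j}. F j i)"
        by (simp add: linear_sum linear_scale scaleR_sum_right F_def)
    qed
    finally show ?thesis .
  qed
  have anti: "F i j = - F j i" if "i \<in> R" "j \<in> R" "i \<noteq> j" for i j
  proof -
    have "koszul_sign i S * koszul_sign j (insert i S) = - (koszul_sign j S * koszul_sign i (insert j S))"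
      using that fin by (auto simp: koszul_sign_insert R_def)
    moreover have "A i (A j x) = A j (A i x)" for x using comm that by (auto simp: R_def)
    ultimately show ?thesis by (simp add: F_def insert_commute)
  qed
  define Z where "Z = (\<Sum>j\<in>R. \<Sum>i\<in>R - {j}. F j i)"
  have "finite R" by (simp add: R_def)
  then have off: "(\<Sum>i\<in>R - {j}. G i) = (\<Sum>i\<in>R. if i = j then 0 else G i)" for j and G :: "nat \<Rightarrow> 'a"
    by (intro sum.mono_neutral_cong_left) auto
  have "Z = (\<Sum>j\<in>R. \<Sum>i\<in>R. if i = j then 0 else F j i)"
    unfolding Z_def off ..
  also have "\<dots> = (\<Sum>i\<in>R. \<Sum>j\<in>R. if i = j then 0 else F j i)" by (rule sum.swap)
  also have "\<dots> = (\<Sum>i\<in>R. \<Sum>j\<in>R. - (if j = i then 0 else F i j))"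
    using anti by (intro sum.cong refl) (metis add.inverse_neutral)
  also have "\<dots> = - (\<Sum>i\<in>R. \<Sum>j\<in>R. if j = i then 0 else F i j)" by (simp add: sum_negf)
  also have "(\<Sum>i\<in>R. \<Sum>j\<in>R. if j = i then 0 else F i j) = Z"
    unfolding Z_def off ..
  finally have "Z = - Z" .
  then have "Z = 0" by (metis add.right_inverse scaleR_2 scaleR_eq_0_iff zero_neq_numeral)
  then show ?thesis using eq unfolding Z_def by simp
qed (simp add: koszul_bd_def)

text \<open>Exterior multiplication by the tuple \<open>B\<close>, whereas \<open>koszul_bd\<close>
  is contraction with the tuple \<open>A\<close>.\<close>

definition koszul_htpy :: "nat \<Rightarrow> (nat \<Rightarrow> 'a \<Rightarrow> 'a) \<Rightarrow> (nat set \<Rightarrow> 'a::real_vector) \<Rightarrow> nat set \<Rightarrow> 'a" where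
  "koszul_htpy d B f S =
     (if S \<subseteq> {..<d} then \<Sum>j\<in>S. koszul_sign j (S - {j}) *\<^sub>R B j (f (S - {j})) else 0)"

lemma koszul_htpy_chain:
  assumes "f \<in> koszul_chain d k" "\<And>j. j < d \<Longrightarrow> B j 0 = 0"
  shows "koszul_htpy d B f \<in> koszul_chain d (Suc k)"
proof -
  have "S \<subseteq> {..<d} \<and> card S = Suc k" if "koszul_htpy d B f S \<noteq> 0" for S
  proof -
    have S: "S \<subseteq> {..<d}" using that by (auto simp: koszul_htpy_def split: if_splits)
    with that obtain j where "j \<in> S" "B j (f (S - {j})) \<noteq> 0"
      by (force simp: koszul_htpy_def intro: sum.neutral)
    then have "j \<in> S" "f (S - {j}) \<noteq> 0" using assms(2) S by auto
    then have "card (S - {j}) = k" using assms(1) by (auto simp: koszul_chain_def)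
    then show ?thesis using S \<open>j \<in> S\<close> finite_subset[OF S] by (metis card_Suc_Diff1 finite_lessThan)
  qed
  then show ?thesis by (auto simp: koszul_chain_def)
qed

text \<open>Terms in which the same index enters and leaves have sign 1; they come from the first
  composite for j outside S and from the second for j in S. The mixed terms cancel in pairs.\<close>

lemma koszul_htpy_formula:
  fixes A B :: "nat \<Rightarrow> 'a::real_vector \<Rightarrow> 'a"
  assumes linA: "\<And>j. j < d \<Longrightarrow> linear (A j)" and linB: "\<And>j. j < d \<Longrightarrow> linear (B j)"
    and comm: "\<And>i j x. i < d \<Longrightarrow> j < d \<Longrightarrow> A i (B j x) = B j (A i x)"
    and S: "S \<subseteq> {..<d}"
  shows "koszul_bd d A (koszul_htpy d B f) S + koszul_htpy d B (koszul_bd d A f) S = (\<Sum>j<d. B j (A j (f S)))"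
proof -
  have fin: "finite S" using S finite_subset by blast
  define R where "R = {..<d} - S"
  define G where "G j i = (koszul_sign j S * koszul_sign i (insert j S - {i})) *\<^sub>R B i (A j (f (insert j S - {i})))" for j i
  have l: "koszul_bd d A (koszul_htpy d B f) S = (\<Sum>j\<in>R. B j (A j (f S)) + (\<Sum>i\<in>S. G j i))"
  proof -
    have "koszul_bd d A (koszul_htpy d B f) S
      = (\<Sum>j\<in>R. koszul_sign j S *\<^sub>R A j (\<Sum>i\<in>insert j S. koszul_sign i (insert j S - {i}) *\<^sub>R B i (f (insert j S - {i}))))"
      using S unfolding koszul_bd_sign by (simp add: R_def) (rule sum.cong, auto simp: koszul_htpy_def)
    also have "\<dots> = (\<Sum>j\<in>R. B j (A j (f S)) + (\<Sum>i\<in>S. G j i))"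
    proof (rule sum.cong[OF refl])
      fix j assume j: "j \<in> R"
      then have jd: "j < d" "j \<notin> S" by (auto simp: R_def)
      have "koszul_sign j S *\<^sub>R A j (\<Sum>i\<in>insert j S. koszul_sign i (insert j S - {i}) *\<^sub>R B i (f (insert j S - {i})))
        = (\<Sum>i\<in>insert j S. (koszul_sign j S * koszul_sign i (insert j S - {i})) *\<^sub>R A j (B i (f (insert j S - {i}))))"
        using linA[OF jd(1)] by (simp add: linear_sum linear_scale scaleR_sum_right)
      also have "\<dots> = (\<Sum>i\<in>insert j S. G j i)"
        unfolding G_def using jd S by (intro sum.cong refl) (auto simp: comm)
      also have "\<dots> = G j j + (\<Sum>i\<in>S. G j i)" using fin jd by simp
      also have "G j j = B j (A j (f S))" using jd by (simp add: G_def koszul_sign_sq)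
      finally show "koszul_sign j S *\<^sub>R A j (\<Sum>i\<in>insert j S. koszul_sign i (insert j S - {i}) *\<^sub>R B i (f (insert j S - {i})))
        = B j (A j (f S)) + (\<Sum>i\<in>S. G j i)" .
    qed
    finally show ?thesis .
  qed
  define H where "H i j = (koszul_sign i (S - {i}) * koszul_sign j (S - {i})) *\<^sub>R B i (A j (f (insert j (S - {i}))))" for i j
  have r: "koszul_htpy d B (koszul_bd d A f) S = (\<Sum>i\<in>S. B i (A i (f S)) + (\<Sum>j\<in>R. H i j))"
  proof -
    have "koszul_htpy d B (koszul_bd d A f) S
      = (\<Sum>i\<in>S. koszul_sign i (S - {i}) *\<^sub>R B i (\<Sum>j\<in>insert i R. koszul_sign j (S - {i}) *\<^sub>R A j (f (insert j (S - {i})))))"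
    proof -
      have "koszul_bd d A f (S - {i}) = (\<Sum>j\<in>insert i R. koszul_sign j (S - {i}) *\<^sub>R A j (f (insert j (S - {i}))))"
        if "i \<in> S" for i
      proof -
        have "{..<d} - (S - {i}) = insert i R" using that S by (auto simp: R_def)
        then show ?thesis using S by (auto simp: koszul_bd_sign)
      qed
      then show ?thesis using S by (simp add: koszul_htpy_def)
    qed
    also have "\<dots> = (\<Sum>i\<in>S. B i (A i (f S)) + (\<Sum>j\<in>R. H i j))"
    proof (rule sum.cong[OF refl])
      fix i assume i: "i \<in> S"
      then have id: "i < d" "i \<notin> R" using S by (auto simp: R_def)
      have "koszul_sign i (S - {i}) *\<^sub>R B i (\<Sum>j\<in>insert i R. koszul_sign j (S - {i}) *\<^sub>R A j (f (insert j (S - {i}))))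
        = (\<Sum>j\<in>insert i R. H i j)"
        using linB[OF id(1)] by (simp add: linear_sum linear_scale scaleR_sum_right H_def)
      also have "\<dots> = H i i + (\<Sum>j\<in>R. H i j)" using id by (simp add: R_def)
      also have "H i i = B i (A i (f S))" using i by (simp add: H_def koszul_sign_sq insert_absorb)
      finally show "koszul_sign i (S - {i}) *\<^sub>R B i (\<Sum>j\<in>insert i R. koszul_sign j (S - {i}) *\<^sub>R A j (f (insert j (S - {i}))))
        = B i (A i (f S)) + (\<Sum>j\<in>R. H i j)" .
    qed
    finally show ?thesis .
  qed
  have anti: "G j i = - H i j" if i: "i \<in> S" and j: "j \<in> R" for i j
  proof -
    obtain S' where S': "S = insert i S'" "i \<notin> S'" using mk_disjoint_insert[OF i] by blast
    have ij: "i \<noteq> j" "j \<notin> S'" "finite S'" using i j S' fin by (auto simp: R_def)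
    have e: "insert j S - {i} = insert j S'" "S - {i} = S'" using S' ij by auto
    have "koszul_sign j S * koszul_sign i (insert j S') = - (koszul_sign i S' * koszul_sign j S')"
      using ij S' by (auto simp: koszul_sign_insert)
    then show ?thesis unfolding G_def H_def e by simp
  qed
  have "(\<Sum>j\<in>R. \<Sum>i\<in>S. G j i) = (\<Sum>i\<in>S. \<Sum>j\<in>R. G j i)" by (rule sum.swap)
  also have "\<dots> = - (\<Sum>i\<in>S. \<Sum>j\<in>R. H i j)" by (simp add: anti sum_negf)
  finally have "koszul_bd d A (koszul_htpy d B f) S + koszul_htpy d B (koszul_bd d A f) S
      = (\<Sum>j\<in>R. B j (A j (f S))) + (\<Sum>i\<in>S. B i (A i (f S)))"
    using l r by (simp add: sum.distrib)
  also have "\<dots> = (\<Sum>j<d. B j (A j (f S)))"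
    unfolding R_def using S by (metis finite_lessThan sum.subset_diff)
  finally show ?thesis .
qed

text \<open>The relation \<open>unit\<close> turns \<open>koszul_htpy\<close> into a contracting
  homotopy: a cycle is the boundary of its image.\<close>

lemma koszul_exact_if_unimodular:
  fixes A B :: "nat \<Rightarrow> 'a::real_vector \<Rightarrow> 'a"
  assumes linA: "\<And>j. j < d \<Longrightarrow> linear (A j)" and linB: "\<And>j. j < d \<Longrightarrow> linear (B j)"
    and commA: "\<And>i j x. i < d \<Longrightarrow> j < d \<Longrightarrow> A i (A j x) = A j (A i x)"
    and comm: "\<And>i j x. i < d \<Longrightarrow> j < d \<Longrightarrow> A i (B j x) = B j (A i x)"
    and unit: "\<And>x. (\<Sum>j<d. B j (A j x)) = x"
  shows "koszul_exact d A TYPE('a)"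
  unfolding koszul_exact_def
proof (intro allI impI equalityI subsetI)
  fix k f
  assume "f \<in> {f \<in> (koszul_chain d k :: (nat set \<Rightarrow> 'a) set). \<forall>S. koszul_bd d A f S = 0}"
  then have f: "f \<in> koszul_chain d k" "koszul_bd d A f = (\<lambda>S. 0)" by auto
  have "koszul_bd d A (koszul_htpy d B f) S = f S" for S
  proof (cases "S \<subseteq> {..<d}")
    case True
    have "koszul_htpy d B (\<lambda>S. 0) S = 0"
      unfolding koszul_htpy_def using linB True by (auto intro!: sum.neutral simp: linear_0 subset_iff)
    then show ?thesis
      using koszul_htpy_formula[of d A B S f] linA linB comm True f(2) unit by simp
  next
    case False
    then show ?thesis using f(1) by (auto simp: koszul_bd_def koszul_chain_def)
  qed
  then have "f = koszul_bd d A (koszul_htpy d B f)" by auto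
  moreover have "koszul_htpy d B f \<in> koszul_chain d (Suc k)"
    using f(1) linB by (intro koszul_htpy_chain) (auto simp: linear_0)
  ultimately show "f \<in> koszul_bd d A ` koszul_chain d (Suc k)" by blast
next
  fix k and f :: "nat set \<Rightarrow> 'a"
  assume "f \<in> koszul_bd d A ` koszul_chain d (Suc k)"
  then obtain g where g: "f = koszul_bd d A g" "g \<in> koszul_chain d (Suc k)" by blast
  have "f \<in> koszul_chain d k" unfolding g using linA by (intro koszul_bd_chain g) (auto simp: linear_0)
  moreover have "koszul_bd d A f S = 0" for S
    unfolding g by (rule koszul_bd_bd) (use linA commA in auto)
  ultimately show "f \<in> {f \<in> koszul_chain d k. \<forall>S. koszul_bd d A f S = 0}" by blast
qed

section \<open>Comparable complete norms\<close>

text \<open>The open mapping theorem for the identity from the norm to \<open>p\<close>. Baire puts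
  a p-ball inside the p-closure of a norm ball, so every vector is approximated up to half its
  p-size by one of controlled norm; summing successive corrections recovers the vector.\<close>

lemma equivalent_complete_norms:
  fixes p :: "'a::banach \<Rightarrow> real"
  assumes add: "\<And>x y. p (x + y) \<le> p x + p y"
    and scale: "\<And>c x. p (c *\<^sub>R x) = \<bar>c\<bar> * p x"
    and zero: "\<And>x. p x = 0 \<Longrightarrow> x = 0"
    and le: "\<And>x. p x \<le> L * norm x"
    and complete: "\<And>\<sigma>. (\<forall>e>0. \<exists>N. \<forall>m\<ge>N. \<forall>n\<ge>N. p (\<sigma> m - \<sigma> n) < e) \<Longrightarrow> \<exists>x. (\<lambda>n. p (\<sigma> n - x)) \<longlonglongrightarrow> 0"
  obtains C where "C > 0" "\<And>x. norm x \<le> C * p x"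
proof -
  have p0 [simp]: "p 0 = 0" using scale[of 0 0] by simp
  have pm: "p (- x) = p x" for x using scale[of "-1" x] by simp
  have pc: "p (x - y) = p (y - x)" for x y using pm[of "x - y"] by simp
  have pos: "0 \<le> p x" for x using add[of x "-x"] pm[of x] by simp
  interpret M: Metric_space UNIV "\<lambda>x y. p (x - y)"
  proof
    show "p (x - y) = 0 \<longleftrightarrow> x = y" for x y using zero[of "x - y"] by auto
    show "p (x - z) \<le> p (x - y) + p (y - z)" for x y z using add[of "x - y" "y - z"] by simp
  qed (use pos pc in auto)
  have comp: "M.mcomplete"
    unfolding M.mcomplete_def
  proof safe
    fix \<sigma> assume "M.MCauchy \<sigma>"
    then have "\<forall>e>0. \<exists>N. \<forall>m\<ge>N. \<forall>n\<ge>N. p (\<sigma> m - \<sigma> n) < e" unfolding M.MCauchy_def by meson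
    then obtain x where "(\<lambda>n. p (\<sigma> n - x)) \<longlonglongrightarrow> 0" using complete by blast
    then have "\<forall>e>0. \<exists>N. \<forall>n\<ge>N. p (\<sigma> n - x) < e"
      by (metis (no_types, lifting) LIMSEQ_iff abs_of_nonneg diff_zero pos real_norm_def)
    then have "limitin M.mtopology \<sigma> x sequentially"
      by (simp only: M.limit_metric_sequentially UNIV_I simp_thms)
    then show "\<exists>x. limitin M.mtopology \<sigma> x sequentially" ..
  qed
  define B where "B m = M.mtopology closure_of {x. norm x \<le> real m}" for m :: nat
  have sub: "{x. norm x \<le> real m} \<subseteq> B m" for m unfolding B_def by (rule closure_of_subset) simp
  have "x \<in> \<Union>(range B)" for x
    using real_arch_simple[of "norm x"] sub by (metis UN_I UNIV_I mem_Collect_eq subsetD)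
  then have "\<Union>(range B) = UNIV" by auto
  have "\<exists>m. M.mtopology interior_of B m \<noteq> {}"
  proof (rule ccontr)
    assume "\<not> ?thesis"
    then have "M.mtopology interior_of \<Union>(range B) = {}"
      by (intro M.metric_Baire_category_alt comp) (auto simp: B_def)
    with \<open>\<Union>(range B) = UNIV\<close> show False
      using interior_of_topspace[of M.mtopology] by simp
  qed
  then obtain m x0 where "x0 \<in> M.mtopology interior_of B m" by blast
  then obtain r where r: "r > 0" "M.mball x0 r \<subseteq> M.mtopology interior_of B m"
    using openin_interior_of[of M.mtopology "B m"] unfolding M.openin_mtopology by blast
  have r_B: "M.mball x0 r \<subseteq> B m"
    using r(2) interior_of_subset[of M.mtopology "B m"] by (rule subset_trans)
  have app: "\<exists>u. norm u \<le> real m \<and> p (y - u) < e" if "p (x0 - y) < r" "e > 0" for y e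
  proof -
    have "y \<in> B m" using r_B that by auto
    then have "\<exists>u\<in>{x. norm x \<le> real m}. u \<in> M.mball y e"
      using that unfolding B_def M.metric_closure_of by blast
    then show ?thesis by auto
  qed
  \<comment> \<open>Differences move the ball from \<open>x0\<close> to the origin and double the
    norm bound.\<close>
  have diff: "\<exists>u. norm u \<le> 2 * real m \<and> p (y - u) < e" if y: "p y < r" "e > 0" for y e
  proof -
    obtain u where u: "norm u \<le> real m" "p (x0 + y - u) < e/2" using app[of "x0 + y" "e/2"] y pm[of y] by auto
    obtain v where v: "norm v \<le> real m" "p (x0 - v) < e/2" using app[of "x0" "e/2"] y r by auto
    have "p (y - (u - v)) \<le> p (x0 + y - u) + p (v - x0)" using add[of "x0 + y - u" "v - x0"] by (simp add: algebra_simps)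
    also have "\<dots> < e" using u v pc[of v x0] by simp
    finally show ?thesis using u v norm_triangle_ineq4[of u v] by (intro exI[of _ "u - v"]) auto
  qed
  \<comment> \<open>Scale y to p-size r / 2 and correct it up to r / 4. Undoing the scaling, a
    factor 2 p(y) / r, turns the norm bound 2 m into K p(y) and leaves an error p(y) / 2.\<close>
  define K where "K = 4 * real m / r"
  have K0: "K \<ge> 0" using r by (simp add: K_def)
  have "\<exists>u. norm u \<le> K * p y \<and> p (y - u) \<le> p y / 2" for y
  proof (cases "y = 0")
    case False
    then have py: "p y > 0" using pos[of y] zero[of y] by linarith
    define c where "c = r / (2 * p y)"
    have c: "c > 0" using r py by (simp add: c_def)
    have "p (c *\<^sub>R y) = r / 2" using py r by (simp add: scale c_def)
    then obtain u where u: "norm u \<le> 2 * real m" "p (c *\<^sub>R y - u) < r / 4" using diff[of "c *\<^sub>R y" "r/4"] r by auto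
    have "norm ((1/c) *\<^sub>R u) \<le> K * p y"
      using u(1) c py r by (simp add: K_def c_def field_simps)
    moreover have "p (y - (1/c) *\<^sub>R u) \<le> p y / 2"
    proof -
      have "y - (1/c) *\<^sub>R u = (1/c) *\<^sub>R (c *\<^sub>R y - u)" using c by (simp add: algebra_simps)
      then have "p (y - (1/c) *\<^sub>R u) = (1/c) * p (c *\<^sub>R y - u)" using c by (simp add: scale)
      also have "\<dots> \<le> (1/c) * (r/4)" using c u(2) by (intro mult_left_mono) auto
      finally show ?thesis using py r by (simp add: c_def)
    qed
    ultimately show ?thesis by blast
  qed (auto intro: exI[of _ 0])
  then obtain U where U: "\<And>y. norm (U y) \<le> K * p y" "\<And>y. p (y - U y) \<le> p y / 2" by metis
  have "norm y \<le> (2 * K) * p y" for y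
  proof -
    \<comment> \<open>The remainder after n corrections. The corrections decay geometrically in
      norm, so their sum u exists, and \<open>le\<close> makes it a limit for \<open>p\<close> as
      well, which identifies it with y.\<close>
    define Y where "Y n = ((\<lambda>z. z - U z) ^^ n) y" for n
    have Y0: "Y 0 = y" and YS: "Y (Suc n) = Y n - U (Y n)" for n by (auto simp: Y_def)
    have pY: "p (Y n) \<le> p y * (1/2)^n" for n
    proof (induction n)
      case (Suc n)
      then show ?case using U(2)[of "Y n"] by (simp add: YS)
    qed (simp add: Y0)
    have nU: "norm (U (Y n)) \<le> K * p y * (1/2)^n" for n
      using U(1)[of "Y n"] mult_left_mono[OF pY K0] by (simp add: mult.assoc) (meson order_trans)
    have sg: "(\<lambda>n. K * p y * (1/2::real)^n) sums (K * p y * 2)"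
      using geometric_sums[of "1/2::real"] by (intro sums_mult) simp
    have sum: "summable (\<lambda>n. norm (U (Y n)))"
      using nU sg by (intro summable_comparison_test'[OF sums_summable[OF sg]]) auto
    define u where "u = (\<Sum>n. U (Y n))"
    have lim: "(\<lambda>n. \<Sum>i<n. U (Y i)) \<longlonglongrightarrow> u"
      unfolding u_def using summable_norm_cancel[OF sum] by (rule summable_LIMSEQ)
    have "norm u \<le> (\<Sum>n. norm (U (Y n)))" unfolding u_def by (rule summable_norm[OF sum])
    also have "\<dots> \<le> K * p y * 2" using nU sum sg by (metis suminf_le sums_summable sums_unique)
    finally have nu: "norm u \<le> K * p y * 2" .
    have tel: "y - (\<Sum>i<n. U (Y i)) = Y n" for n by (induction n) (auto simp: Y0 YS algebra_simps)
    have bound: "p (y - u) \<le> p y * (1/2)^n + L * norm ((\<Sum>i<n. U (Y i)) - u)" for n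
    proof -
      have "y - u = Y n + ((\<Sum>i<n. U (Y i)) - u)" using tel[of n] by (simp add: algebra_simps)
      then have "p (y - u) \<le> p (Y n) + p ((\<Sum>i<n. U (Y i)) - u)" by (metis add)
      then show ?thesis
        using pY[of n] le[of "(\<Sum>i<n. U (Y i)) - u"] by linarith
    qed
    have "(\<lambda>n. p y * (1/2)^n + L * norm ((\<Sum>i<n. U (Y i)) - u)) \<longlonglongrightarrow> p y * 0 + L * 0"
    proof (intro tendsto_add tendsto_mult tendsto_const)
      show "(\<lambda>n. (1/2::real)^n) \<longlonglongrightarrow> 0" by (rule LIMSEQ_power_zero) simp
      show "(\<lambda>n. norm ((\<Sum>i<n. U (Y i)) - u)) \<longlonglongrightarrow> 0"
        by (rule tendsto_norm_zero[OF LIM_zero[OF lim]])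
    qed
    then have "p (y - u) \<le> p y * 0 + L * 0" by (rule LIMSEQ_le_const) (use bound in blast)
    then have "p (y - u) \<le> 0" by simp
    then have "y = u" using pos[of "y - u"] zero[of "y - u"] by simp
    then show ?thesis using nu by (simp add: mult_ac)
  qed
  \<comment> \<open>Adding 1 keeps the constant positive when K = 0.\<close>
  then have "norm y \<le> (2 * K + 1) * p y" for y using pos[of y] by (simp add: distrib_right) (meson add_increasing2)
  then show thesis using K0 that[of "2 * K + 1"] by simp
qed

section \<open>Joint approximate eigenvalues and the Taylor spectrum\<close>

lemma simultaneous_convergent_subsequence:
  fixes f :: "nat \<Rightarrow> nat \<Rightarrow> complex"
  assumes "\<And>j. j < d \<Longrightarrow> bounded (range (f j))"
  shows "\<exists>r l. strict_mono r \<and> (\<forall>j<d. (\<lambda>n. f j (r n)) \<longlonglongrightarrow> l j)"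
  using assms
proof (induction d)
  case 0
  show ?case by (auto intro!: exI[of _ id] strict_monoI)
next
  case (Suc d)
  then obtain r l where r: "strict_mono (r :: nat \<Rightarrow> nat)" and l: "\<forall>j<d. (\<lambda>n. f j (r n)) \<longlonglongrightarrow> l j"
    using less_SucI by blast
  have "bounded (range (f d \<circ> r))"
    by (rule bounded_subset[OF Suc.prems[of d]]) auto
  then obtain c s where s: "strict_mono (s :: nat \<Rightarrow> nat)" and c: "((f d \<circ> r) \<circ> s) \<longlonglongrightarrow> c"
    using bounded_imp_convergent_subsequence by blast
  have "(\<lambda>n. f j ((r \<circ> s) n)) \<longlonglongrightarrow> (l(d := c)) j" if "j < Suc d" for j
  proof (cases "j = d")
    case True
    then show ?thesis using c by (simp add: o_def)
  next
    case False
    then have "(\<lambda>n. f j (r n)) \<longlonglongrightarrow> l j" using l that by simp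
    from LIMSEQ_subseq_LIMSEQ[OF this s] show ?thesis using False by (simp add: o_def)
  qed
  then show ?case using strict_mono_o[OF r s] by blast
qed

lemma bounded_linear_scaleC: "bounded_linear (scaleC c :: 'a::complex_inner_space \<Rightarrow> 'a)"
  by (rule bounded_linear_intro[where K = "cmod c"])
     (auto simp: scaleC_add_right scaleR_scaleC scaleC_scaleC mult.commute)

lemma bounded_linear_diff_scaleC:
  assumes "bounded_clinear T"
  shows "bounded_linear (\<lambda>x. T x - scaleC c x)"
  using assms bounded_linear_scaleC bounded_linear_sub unfolding bounded_clinear_def by blast

text \<open>The joint approximate point spectrum in \<epsilon>-form. Only the first \<open>d\<close>
  values of \<open>l\<close> are constrained, so \<open>l\<close> can be built one coordinate at a
  time.\<close>

definition approximate_joint_eigenvalue :: "nat \<Rightarrow> (nat \<Rightarrow> 'a \<Rightarrow> 'a::complex_inner_space) \<Rightarrow> (nat \<Rightarrow> complex) \<Rightarrow> bool" where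
  "approximate_joint_eigenvalue d T l \<longleftrightarrow>
     (\<forall>\<epsilon>>0. \<exists>x. norm x = 1 \<and> (\<forall>j<d. norm (T j x - scaleC (l j) x) \<le> \<epsilon>))"

text \<open>Induction on the number of operators: \<open>g\<close> is the defect of the first k
  equations, and \<open>approximate_eigenvector\<close> makes it small together with the defect of
  the next one.\<close>

lemma approximate_joint_eigenvalue_exists:
  fixes T :: "nat \<Rightarrow> 'a::complex_inner_space \<Rightarrow> 'a"
  assumes T: "\<And>k. k < d \<Longrightarrow> bounded_clinear (T k)"
    and comm: "\<And>i j x. i < d \<Longrightarrow> j < d \<Longrightarrow> T i (T j x) = T j (T i x)"
    and nontrivial: "\<exists>x::'a. norm x = 1"
  shows "\<exists>l. approximate_joint_eigenvalue d T l"
proof -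
  have "k \<le> d \<Longrightarrow> \<exists>l. approximate_joint_eigenvalue k T l" for k
  proof (induction k)
    case 0
    then show ?case using nontrivial by (auto simp: approximate_joint_eigenvalue_def)
  next
    case (Suc k)
    then obtain l where l: "approximate_joint_eigenvalue k T l" by auto
    have k: "k < d" using Suc.prems by simp
    interpret T: bounded_linear "T k" using T[OF k] by (simp add: bounded_clinear_def)
    have Tc: "T j (scaleC c x) = scaleC c (T j x)" if "j < d" for j c x
      using T[OF that] by (simp add: bounded_clinear_def)
    have Ta: "T j (x + y) = T j x + T j y" if "j < d" for j x y
      using T[OF that] by (simp add: bounded_clinear_def bounded_linear.linear linear_add)
    obtain K0 where K0: "K0 > 0" "\<And>x. norm (T k x) \<le> norm x * K0" using T.pos_bounded by blast
    define K where "K = K0 + 1"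
    \<comment> \<open>The shift makes \<open>B\<close> expanding, which rules out spectral radius 0.\<close>
    define B where "B x = T k x + scaleC (of_real K) x" for x
    define M where "M = K0 + K"
    define g where "g x = (\<Sum>j<k. norm (T j x - scaleC (l j) x))" for x
    have M: "M \<ge> 1" "norm (B x) \<le> M * norm x" and expand: "norm x \<le> norm (B x)" for x
    proof -
      show "M \<ge> 1" using K0 by (simp add: M_def K_def)
      have Kx: "norm (scaleC (of_real K) x) = K * norm x" using K0 by (simp add: K_def)
      show "norm (B x) \<le> M * norm x"
        using norm_triangle_ineq[of "T k x" "scaleC (of_real K) x"] K0(2)[of x] Kx
        unfolding B_def M_def by (simp only: algebra_simps)
      have "norm (scaleC (of_real K) x) \<le> norm (B x) + norm (T k x)"
        unfolding B_def by (metis add_diff_cancel_left' norm_triangle_ineq4)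
      then show "norm x \<le> norm (B x)" using K0(2)[of x] Kx by (simp add: K_def algebra_simps)
    qed
    have Badd: "B (x + y) = B x + B y" for x y
      by (simp add: B_def T.add scaleC_add_right)
    have Bscale: "B (scaleC c x) = scaleC c (B x)" for c x
      by (simp add: B_def Tc[OF k] scaleC_add_right scaleC_scaleC mult.commute)
    have gadd: "g (x + y) \<le> g x + g y" for x y
      unfolding g_def sum.distrib[symmetric]
    proof (rule sum_mono)
      fix j assume "j \<in> {..<k}"
      then have "T j (x + y) - scaleC (l j) (x + y) = (T j x - scaleC (l j) x) + (T j y - scaleC (l j) y)"
        using k by (simp add: Ta scaleC_add_right)
      then show "norm (T j (x + y) - scaleC (l j) (x + y)) \<le> norm (T j x - scaleC (l j) x) + norm (T j y - scaleC (l j) y)"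
        by (simp only: norm_triangle_ineq)
    qed
    have gscale: "g (scaleC c x) = cmod c * g x" for c x
      unfolding g_def sum_distrib_left
    proof (rule sum.cong[OF refl])
      fix j assume "j \<in> {..<k}"
      then have "T j (scaleC c x) - scaleC (l j) (scaleC c x) = scaleC c (T j x - scaleC (l j) x)"
        using k by (simp add: Tc scaleC_diff_right scaleC_scaleC mult.commute)
      then show "norm (T j (scaleC c x) - scaleC (l j) (scaleC c x)) = cmod c * norm (T j x - scaleC (l j) x)"
        by simp
    qed
    \<comment> \<open>Commutativity enters here: \<open>B\<close> commutes with each T_j - l_j, so
      no single defect grows by more than the factor M.\<close>
    have gB: "g (B x) \<le> M * g x" for x
      unfolding g_def sum_distrib_left
    proof (rule sum_mono)
      fix j assume "j \<in> {..<k}"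
      then have j: "j < d" using k by simp
      have "T j (B x) - scaleC (l j) (B x) = B (T j x - scaleC (l j) x)"
        by (simp add: B_def Ta[OF j] Tc[OF j] Tc[OF k] comm[OF k j] T.diff scaleC_add_right scaleC_diff_right scaleC_scaleC mult.commute)
      then show "norm (T j (B x) - scaleC (l j) (B x)) \<le> M * norm (T j x - scaleC (l j) x)"
        using M(2) by simp
    qed
    have ex: "\<exists>x. norm x = 1 \<and> g x \<le> \<delta>" if "\<delta> > 0" for \<delta>
    proof -
      have "\<delta> / Suc k > 0" using that by simp
      then obtain x where x: "norm x = 1" "\<forall>j<k. norm (T j x - scaleC (l j) x) \<le> \<delta> / Suc k"
        using l unfolding approximate_joint_eigenvalue_def by blast
      have "g x \<le> (\<Sum>j<k. \<delta> / Suc k)" unfolding g_def using x by (intro sum_mono) auto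
      also have "\<dots> \<le> \<delta>" using that by (simp add: field_simps)
      finally show ?thesis using x by blast
    qed
    have "\<exists>\<mu> x. cmod \<mu> \<le> M \<and> norm x = 1 \<and> g x \<le> inverse (real (Suc n)) \<and> norm (B x - scaleC \<mu> x) \<le> inverse (real (Suc n))" for n
      by (rule approximate_eigenvector[OF Badd Bscale M expand gadd gscale gB ex]) auto
    then obtain \<mu> x where \<mu>: "\<And>n. cmod (\<mu> n) \<le> M" and x1: "\<And>n. norm (x n) = 1"
      and gx: "\<And>n. g (x n) \<le> inverse (real (Suc n))" and Bx: "\<And>n. norm (B (x n) - scaleC (\<mu> n) (x n)) \<le> inverse (real (Suc n))"
      by metis
    \<comment> \<open>The values \<mu> vary with the precision; compactness supplies one limit c,
      and c - K undoes the shift.\<close>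
    have "bounded (range \<mu>)" using \<mu> by (auto simp: bounded_iff)
    then obtain c r where r: "strict_mono (r :: nat \<Rightarrow> nat)" and c: "(\<mu> \<circ> r) \<longlonglongrightarrow> c"
      using bounded_imp_convergent_subsequence by blast
    have "\<exists>y. norm y = 1 \<and> (\<forall>j<Suc k. norm (T j y - scaleC ((l(k := c - of_real K)) j) y) \<le> \<epsilon>)" if \<epsilon>: "\<epsilon> > 0" for \<epsilon>
    proof -
      have "eventually (\<lambda>n. dist ((\<mu> \<circ> r) n) c < \<epsilon> / 2) sequentially"
        by (rule tendstoD[OF c]) (use \<epsilon> in simp)
      moreover have "eventually (\<lambda>n. inverse (real (Suc n)) < \<epsilon> / 2) sequentially"
        using order_tendstoD(2)[OF LIMSEQ_inverse_real_of_nat, of "\<epsilon> / 2"] \<epsilon> by simp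
      ultimately have "eventually (\<lambda>n. dist ((\<mu> \<circ> r) n) c < \<epsilon> / 2 \<and> inverse (real (Suc n)) < \<epsilon> / 2) sequentially"
        by (rule eventually_conj)
      then obtain n where n: "dist (\<mu> (r n)) c < \<epsilon> / 2" "inverse (real (Suc n)) < \<epsilon> / 2"
        by (auto simp: eventually_sequentially)
      have "inverse (real (Suc (r n))) \<le> inverse (real (Suc n))"
        using seq_suble[OF r, of n] by (intro le_imp_inverse_le) auto
      then have small: "inverse (real (Suc (r n))) < \<epsilon> / 2" using n(2) by linarith
      define y where "y = x (r n)"
      have "norm (T j y - scaleC ((l(k := c - of_real K)) j) y) \<le> \<epsilon>" if j: "j < Suc k" for j
      proof (cases "j = k")
        case True
        have "T k y - scaleC (c - of_real K) y = (B y - scaleC (\<mu> (r n)) y) + scaleC (\<mu> (r n) - c) y"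
          by (simp add: B_def scaleC_diff_left)
        then have "norm (T k y - scaleC (c - of_real K) y) \<le> norm (B y - scaleC (\<mu> (r n)) y) + norm (scaleC (\<mu> (r n) - c) y)"
          by (simp only: norm_triangle_ineq)
        also have "\<dots> \<le> \<epsilon>"
          using Bx[of "r n"] small n(1) x1[of "r n"] by (simp add: y_def dist_norm)
        finally show ?thesis using True by simp
      next
        case False
        then have "norm (T j y - scaleC (l j) y) \<le> g y"
          unfolding g_def using j by (intro member_le_sum[of j "{..<k}" "\<lambda>j. norm (T j y - scaleC (l j) y)"]) auto
        also have "\<dots> \<le> \<epsilon>" using gx[of "r n"] small \<epsilon> by (simp add: y_def)
        finally show ?thesis using False by simp
      qed
      moreover have "norm y = 1" by (simp add: y_def x1)
      ultimately show ?thesis by blast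
    qed
    then show ?case unfolding approximate_joint_eigenvalue_def by blast
  qed
  then show ?thesis by simp
qed

text \<open>A chain of degree d is a single vector x; up to signs its boundary is the tuple (A_j
  x)_j, placed at the complements of the singletons.\<close>

lemma koszul_bd_top:
  assumes "j < d"
  shows "koszul_bd d A (\<lambda>S. if S = {..<d} then x else 0) ({..<d} - {j}) = koszul_sign j ({..<d} - {j}) *\<^sub>R A j x"
proof -
  have "{..<d} - ({..<d} - {j}) = {j}" "insert j ({..<d} - {j}) = {..<d}" using assms by auto
  then show ?thesis by (simp add: koszul_bd_sign)
qed

lemma koszul_bd_top_eq_0:
  assumes "\<And>j. j < d \<Longrightarrow> S \<noteq> {..<d} - {j}" "\<And>j. j < d \<Longrightarrow> A j 0 = 0"
  shows "koszul_bd d A (\<lambda>S. if S = {..<d} then x else 0) S = 0"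
proof -
  have "insert j S \<noteq> {..<d}" if "j \<in> {..<d} - S" for j
    using assms(1)[of j] that by (metis Diff_iff Diff_insert_absorb lessThan_iff)
  then show ?thesis using assms(2) by (auto simp: koszul_bd_sign intro!: sum.neutral)
qed

text \<open>The sum of the |A_j x| is a norm by exactness in degree d and complete by exactness in
  degree d - 1: if all A_j x_n converge, the limit tuple is a cycle, hence the image tuple of one
  vector.\<close>

lemma koszul_exact_imp_bounded_below:
  fixes A :: "nat \<Rightarrow> 'a::banach \<Rightarrow> 'a"
  assumes "d \<ge> 1" and A: "\<And>j. j < d \<Longrightarrow> bounded_linear (A j)"
    and comm: "\<And>i j x. i < d \<Longrightarrow> j < d \<Longrightarrow> A i (A j x) = A j (A i x)"
    and exact: "koszul_exact d A TYPE('a)"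
  obtains C where "C > 0" "\<And>x. norm x \<le> C * (\<Sum>j<d. norm (A j x))"
proof -
  have lin: "linear (A j)" if "j < d" for j using A[OF that] by (rule bounded_linear.linear)
  have A0: "A j 0 = 0" if "j < d" for j using lin[OF that] by (rule linear_0)
  define F where "F x = (\<lambda>S. if S = {..<d} then x else 0)" for x :: 'a
  define p where "p x = (\<Sum>j<d. norm (A j x))" for x
  have exact_at: "f \<in> koszul_chain d k \<Longrightarrow> \<forall>S. koszul_bd d A f S = 0 \<Longrightarrow> k \<le> d \<Longrightarrow>
      \<exists>g \<in> koszul_chain d (Suc k). f = koszul_bd d A g" for f k
    using exact unfolding koszul_exact_def by blast
  have "\<forall>j. \<exists>L. j < d \<longrightarrow> (\<forall>x. norm (A j x) \<le> norm x * L)"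
    using A bounded_linear.bounded by blast
  then obtain L where L: "\<And>j x. j < d \<Longrightarrow> norm (A j x) \<le> norm x * L j" by metis
  show thesis
  proof (rule equivalent_complete_norms[of p "\<Sum>j<d. L j"])
    show "p (x + y) \<le> p x + p y" for x y
      unfolding p_def sum.distrib[symmetric]
      by (rule sum_mono) (simp add: lin linear_add norm_triangle_ineq)
    show "p (c *\<^sub>R x) = \<bar>c\<bar> * p x" for c x
      unfolding p_def sum_distrib_left by (rule sum.cong) (simp_all add: lin linear_scale)
    show "p x \<le> (\<Sum>j<d. L j) * norm x" for x
      unfolding p_def sum_distrib_right by (rule sum_mono) (metis L lessThan_iff mult.commute)
    show "x = 0" if "p x = 0" for x
    proof -
      have z: "A j x = 0" if "j < d" for j
        using \<open>p x = 0\<close> that unfolding p_def by (simp add: sum_nonneg_eq_0_iff)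
      have "koszul_bd d A (F x) S = 0" for S
      proof (cases "\<exists>j<d. S = {..<d} - {j}")
        case True
        then show ?thesis using koszul_bd_top[of _ d A x] z by (auto simp: F_def)
      next
        case False
        then show ?thesis unfolding F_def using A0 by (intro koszul_bd_top_eq_0) auto
      qed
      moreover have "F x \<in> koszul_chain d d" by (auto simp: koszul_chain_def F_def)
      ultimately obtain g where "F x = koszul_bd d A g" using exact_at by blast
      \<comment> \<open>At the full set no index is left to insert, so every boundary vanishes
        there.\<close>
      then have "F x {..<d} = koszul_bd d A g {..<d}" by simp
      then show ?thesis by (simp add: koszul_bd_def F_def)
    qed
    show "\<exists>x. (\<lambda>n. p (\<sigma> n - x)) \<longlonglongrightarrow> 0"
      if cau: "\<forall>e>0. \<exists>N. \<forall>m\<ge>N. \<forall>n\<ge>N. p (\<sigma> m - \<sigma> n) < e" for \<sigma>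
    proof -
      have conv: "convergent (\<lambda>n. A j (\<sigma> n))" if j: "j < d" for j
      proof -
        have "norm (A j (\<sigma> m) - A j (\<sigma> n)) \<le> p (\<sigma> m - \<sigma> n)" for m n
          using j member_le_sum[of j "{..<d}" "\<lambda>j. norm (A j (\<sigma> m - \<sigma> n))"]
          by (simp add: p_def lin linear_diff)
        then have "Cauchy (\<lambda>n. A j (\<sigma> n))"
          unfolding Cauchy_iff using cau by (meson order_le_less_trans)
        then show ?thesis by (simp add: Cauchy_convergent_iff)
      qed
      define h where "h S = lim (\<lambda>n. koszul_bd d A (F (\<sigma> n)) S)" for S
      have lim: "(\<lambda>n. koszul_bd d A (F (\<sigma> n)) S) \<longlonglongrightarrow> h S" for S
      proof (cases "\<exists>j<d. S = {..<d} - {j}")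
        case True
        then obtain j where j: "j < d" "S = {..<d} - {j}" by blast
        have "convergent (\<lambda>n. koszul_bd d A (F (\<sigma> n)) S)"
          unfolding F_def j(2) koszul_bd_top[OF j(1)]
          using conv[OF j(1)] tendsto_scaleR[OF tendsto_const] unfolding convergent_def by fast
        then show ?thesis unfolding h_def by (simp add: convergent_LIMSEQ_iff)
      next
        case False
        then have "koszul_bd d A (F (\<sigma> n)) S = 0" for n
          unfolding F_def using A0 by (intro koszul_bd_top_eq_0) auto
        then show ?thesis unfolding h_def by simp
      qed
      have hc: "h \<in> koszul_chain d (d - 1)"
      proof -
        have "S \<subseteq> {..<d} \<and> card S = d - 1" if "h S \<noteq> 0" for S
        proof -
          have "\<exists>j<d. S = {..<d} - {j}"
          proof (rule ccontr)
            assume "\<not> ?thesis"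
            then have "koszul_bd d A (F (\<sigma> n)) S = 0" for n
              unfolding F_def using A0 by (intro koszul_bd_top_eq_0) auto
            then have "h S = 0" unfolding h_def by simp
            then show False using that by simp
          qed
          then show ?thesis by auto
        qed
        then show ?thesis by (auto simp: koszul_chain_def)
      qed
      have "koszul_bd d A h S = 0" for S
      proof -
        have "(\<lambda>n. koszul_bd d A (koszul_bd d A (F (\<sigma> n))) S) \<longlonglongrightarrow> koszul_bd d A h S"
        proof (cases "S \<subseteq> {..<d}")
          case True
          have "(\<lambda>n. \<Sum>j\<in>{..<d} - S. koszul_sign j S *\<^sub>R A j (koszul_bd d A (F (\<sigma> n)) (insert j S)))
              \<longlonglongrightarrow> (\<Sum>j\<in>{..<d} - S. koszul_sign j S *\<^sub>R A j (h (insert j S)))"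
            using lim A by (intro tendsto_sum tendsto_scaleR tendsto_const bounded_linear.tendsto[of "A _"]) auto
          then show ?thesis using True unfolding koszul_bd_sign[of d A h] koszul_bd_sign[of d A "koszul_bd d A (F (\<sigma> _))"] by simp
        qed (simp add: koszul_bd_def)
        moreover have "koszul_bd d A (koszul_bd d A (F (\<sigma> n))) S = 0" for n
          by (rule koszul_bd_bd) (use lin comm in auto)
        ultimately show ?thesis by (simp add: LIMSEQ_const_iff)
      qed
      then obtain g where g: "g \<in> koszul_chain d (Suc (d - 1))" "h = koszul_bd d A g"
        using exact_at[OF hc] by auto
      define x where "x = g {..<d}"
      have "g = F x"
      proof
        fix S
        have "S = {..<d}" if "g S \<noteq> 0"
        proof -
          have "S \<subseteq> {..<d}" "card S = card {..<d}"
            using g(1) that \<open>d \<ge> 1\<close> by (auto simp: koszul_chain_def)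
          then show ?thesis by (simp add: card_subset_eq)
        qed
        then show "g S = F x S" by (auto simp: F_def x_def)
      qed
      have "(\<lambda>n. norm (A j (\<sigma> n - x))) \<longlonglongrightarrow> 0" if j: "j < d" for j
      proof -
        let ?s = "koszul_sign j ({..<d} - {j})"
        have "(\<lambda>n. ?s *\<^sub>R A j (\<sigma> n)) \<longlonglongrightarrow> ?s *\<^sub>R A j x"
          using lim[of "{..<d} - {j}"] unfolding g(2) \<open>g = F x\<close> F_def koszul_bd_top[OF j] .
        then have "(\<lambda>n. ?s *\<^sub>R (?s *\<^sub>R A j (\<sigma> n))) \<longlonglongrightarrow> ?s *\<^sub>R (?s *\<^sub>R A j x)"
          by (rule tendsto_scaleR[OF tendsto_const])
        then have "(\<lambda>n. A j (\<sigma> n)) \<longlonglongrightarrow> A j x" by (simp only: scaleR_scaleR koszul_sign_sq scaleR_one)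
        then have "(\<lambda>n. A j (\<sigma> n) - A j x) \<longlonglongrightarrow> 0" by (rule LIM_zero)
        then show ?thesis using j by (simp add: lin linear_diff tendsto_norm_zero)
      qed
      then have "(\<lambda>n. p (\<sigma> n - x)) \<longlonglongrightarrow> (\<Sum>j<d. 0)" unfolding p_def by (intro tendsto_sum) auto
      then show ?thesis by auto
    qed
    show "\<And>C. 0 < C \<Longrightarrow> (\<And>x. norm x \<le> C * p x) \<Longrightarrow> thesis" using that unfolding p_def by blast
  qed
qed

text \<open>An approximate eigenvector violates the lower bound that exactness would give. The
  truncation is forced by \<open>taylor_spectrum\<close>, whose points vanish from \<open>d\<close>
  on.\<close>

lemma approximate_joint_eigenvalue_in_taylor_spectrum:
  fixes T :: "nat \<Rightarrow> 'a::complex_hilbert_space \<Rightarrow> 'a"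
  assumes d: "d \<ge> 1" and T: "\<And>k. k < d \<Longrightarrow> bounded_clinear (T k)"
    and comm: "\<And>i j x. i < d \<Longrightarrow> j < d \<Longrightarrow> T i (T j x) = T j (T i x)"
    and l: "approximate_joint_eigenvalue d T l"
  shows "(\<lambda>j. if j < d then l j else 0) \<in> taylor_spectrum d T"
proof -
  define z where "z = (\<lambda>j. if j < d then l j else 0)"
  define A where "A = (\<lambda>j x. T j x - scaleC (z j) x)"
  have "\<not> koszul_exact d A TYPE('a)"
  proof
    assume ex: "koszul_exact d A TYPE('a)"
    have bl: "bounded_linear (A j)" if "j < d" for j
      unfolding A_def using bounded_linear_diff_scaleC[OF T[OF that]] .
    have cA: "A i (A j x) = A j (A i x)" if "i < d" "j < d" for i j x
    proof -
      have *: "T i (x - y) = T i x - T i y" "T i (scaleC c x) = scaleC c (T i x)" if "i < d" for i x y c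
        using T[OF that] by (auto simp: bounded_clinear_def bounded_linear.linear linear_diff)
      show ?thesis using that by (simp add: A_def * comm[of i j] scaleC_diff_right scaleC_scaleC mult.commute)
    qed
    obtain C where C: "C > 0" "\<And>x. norm x \<le> C * (\<Sum>j<d. norm (A j x))"
      using koszul_exact_imp_bounded_below[OF d bl cA ex] by blast
    \<comment> \<open>Chosen so that the lower bound reads 1 \<le> 1 / 2 at a unit vector.\<close>
    define \<epsilon> where "\<epsilon> = 1 / (2 * C * d)"
    have "\<epsilon> > 0" using C d by (simp add: \<epsilon>_def)
    then obtain x where x: "norm x = 1" "\<forall>j<d. norm (T j x - scaleC (l j) x) \<le> \<epsilon>"
      using l unfolding approximate_joint_eigenvalue_def by blast
    have "(\<Sum>j<d. norm (A j x)) \<le> (\<Sum>j<d. \<epsilon>)" using x(2) by (intro sum_mono) (simp add: A_def z_def)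
    then have "C * (\<Sum>j<d. norm (A j x)) \<le> C * (d * \<epsilon>)" using C(1) by simp
    also have "\<dots> = 1 / 2" using C(1) d by (simp add: \<epsilon>_def)
    finally show False using C(2)[of x] x(1) by simp
  qed
  then show ?thesis unfolding taylor_spectrum_def A_def z_def by simp
qed

text \<open>S = sum_j b_j A_j is invertible and commutes with every A_i, hence so does its inverse
  R, and sum_j (R b_j) A_j = R S = 1.\<close>

lemma coercive_imp_koszul_exact:
  fixes A :: "nat \<Rightarrow> 'a::complex_hilbert_space \<Rightarrow> 'a" and b :: "nat \<Rightarrow> complex"
  assumes A: "\<And>j. j < d \<Longrightarrow> bounded_clinear (A j)"
    and comm: "\<And>i j x. i < d \<Longrightarrow> j < d \<Longrightarrow> A i (A j x) = A j (A i x)"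
    and c: "c > 0" and coercive: "\<And>x. c * (norm x)\<^sup>2 \<le> Re (cinner (\<Sum>j<d. scaleC (b j) (A j x)) x)"
  shows "koszul_exact d A TYPE('a)"
proof -
  define S where "S x = (\<Sum>j<d. scaleC (b j) (A j x))" for x
  have bl: "bounded_linear (A j)" if "j < d" for j using A[OF that] by (simp add: bounded_clinear_def)
  have lin: "linear (A j)" if "j < d" for j using bl[OF that] by (rule bounded_linear.linear)
  have Ac: "A j (scaleC a x) = scaleC a (A j x)" if "j < d" for j a x
    using A[OF that] by (simp add: bounded_clinear_def)
  have S: "bounded_linear S"
    unfolding S_def using bl
    by (intro bounded_linear_sum bounded_linear_compose[OF bounded_linear_scaleC]) auto
  have "bij S" using lax_milgram[OF S c] coercive by (simp add: S_def)
  define R where "R = inv S"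
  have RS: "R (S x) = x" and SR: "S (R x) = x" for x
    using \<open>bij S\<close> by (simp_all add: R_def bij_is_inj bij_is_surj surj_f_inv_f)
  interpret S: bounded_linear S by (rule S)
  have linR: "linear R"
  proof (rule linearI)
    show "R (x + y) = R x + R y" for x y by (metis RS SR S.add)
    show "R (a *\<^sub>R x) = a *\<^sub>R R x" for a x by (metis RS SR S.scaleR)
  qed
  have SA: "S (A i x) = A i (S x)" if "i < d" for i x
    unfolding S_def using that by (simp add: lin linear_sum Ac comm[of i])
  have RA: "R (A i x) = A i (R x)" if "i < d" for i x
    using SA[OF that, of "R x"] by (metis RS SR)
  show ?thesis
  proof (rule koszul_exact_if_unimodular)
    \<comment> \<open>The complex scalars b_j are absorbed into the homotopy operators, since the
      Koszul lemmas are real-linear.\<close>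
    show "linear (\<lambda>x. R (scaleC (b j) x))" for j
      using linear_compose[OF bounded_linear.linear[OF bounded_linear_scaleC] linR] by (simp add: o_def)
    show "A i (R (scaleC (b j) x)) = R (scaleC (b j) (A i x))" if "i < d" for i j x
      using that by (simp add: Ac flip: RA)
    show "(\<Sum>j<d. R (scaleC (b j) (A j x))) = x" for x
      using RS[of x] linR by (simp add: S_def linear_sum)
  qed (use lin comm in auto)
qed

lemma bounded_clinear_diff_scaleC:
  assumes "bounded_clinear T"
  shows "bounded_clinear (\<lambda>x. T x - scaleC c x)"
  using assms bounded_linear_diff_scaleC[OF assms]
  by (simp add: bounded_clinear_def scaleC_diff_right scaleC_scaleC mult.commute)

text \<open>On unit vectors the form of - sum_j conj(z_j) (T_j - z_j) is r^2 - sum_j conj(z_j) <T_j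
  x, x> with r = |z|. By Cauchy-Schwarz the sum has modulus at most r w, so r > w gives the
  coercivity constant r^2 - r w.\<close>

lemma taylor_spectrum_le_numerical_radius:
  fixes T :: "nat \<Rightarrow> 'a::complex_hilbert_space \<Rightarrow> 'a"
  assumes T: "\<And>k. k < d \<Longrightarrow> bounded_clinear (T k)"
    and comm: "\<And>i j x. i < d \<Longrightarrow> j < d \<Longrightarrow> T i (T j x) = T j (T i x)"
    and w: "0 \<le> w" "\<And>x. norm x = 1 \<Longrightarrow> sqrt (\<Sum>k<d. (cmod (cinner (T k x) x))\<^sup>2) \<le> w"
    and z: "z \<in> taylor_spectrum d T"
  shows "sqrt (\<Sum>j<d. (cmod (z j))\<^sup>2) \<le> w"
proof (rule ccontr)
  define r where "r = sqrt (\<Sum>j<d. (cmod (z j))\<^sup>2)"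
  assume "\<not> ?thesis"
  then have r: "w < r" by (simp add: r_def)
  define A where "A = (\<lambda>j x. T j x - scaleC (z j) x)"
  have cA: "A i (A j x) = A j (A i x)" if "i < d" "j < d" for i j x
  proof -
    have *: "T i (x - y) = T i x - T i y" "T i (scaleC c x) = scaleC c (T i x)" if "i < d" for i x y c
      using T[OF that] by (auto simp: bounded_clinear_def bounded_linear.linear linear_diff)
    show ?thesis using that by (simp add: A_def * comm[of i j] scaleC_diff_right scaleC_scaleC mult.commute)
  qed
  have rr: "complex_of_real (r\<^sup>2) = (\<Sum>j<d. cnj (z j) * z j)"
  proof -
    have "r\<^sup>2 = (\<Sum>j<d. (cmod (z j))\<^sup>2)" by (simp add: r_def sum_nonneg)
    then show ?thesis by (simp only: of_real_sum complex_norm_square mult.commute)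
  qed
  have form: "cinner (\<Sum>j<d. scaleC (- cnj (z j)) (A j x)) x
      = of_real (r\<^sup>2) * cinner x x - (\<Sum>j<d. cnj (z j) * cinner (T j x) x)" for x
    unfolding rr sum_distrib_right sum_subtractf[symmetric]
    by (simp add: A_def cinner_sum_left cinner_scaleC_left cinner_diff_left algebra_simps)
  have unit: "r\<^sup>2 - r * w \<le> Re (cinner (\<Sum>j<d. scaleC (- cnj (z j)) (A j x)) x)" if x: "norm x = 1" for x
  proof -
    have "cmod (\<Sum>j<d. cnj (z j) * cinner (T j x) x) \<le> (\<Sum>j<d. \<bar>cmod (z j)\<bar> * \<bar>cmod (cinner (T j x) x)\<bar>)"
      by (rule order_trans[OF norm_sum]) (simp add: norm_mult)
    also have "\<dots> \<le> L2_set (\<lambda>j. cmod (z j)) {..<d} * L2_set (\<lambda>j. cmod (cinner (T j x) x)) {..<d}"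
      by (rule L2_set_mult_ineq)
    also have "\<dots> \<le> r * w"
      using w(2)[OF x] r w(1) by (intro mult_mono) (auto simp: L2_set_def r_def intro: sum_nonneg)
    finally have "Re (\<Sum>j<d. cnj (z j) * cinner (T j x) x) \<le> r * w"
      using complex_Re_le_cmod order_trans by blast
    then show ?thesis unfolding form using x by (simp add: cinner_self_norm)
  qed
  have "koszul_exact d A TYPE('a)"
  proof (rule coercive_imp_koszul_exact[where b = "\<lambda>j. - cnj (z j)"])
    show "bounded_clinear (A j)" if "j < d" for j
      unfolding A_def by (rule bounded_clinear_diff_scaleC[OF T[OF that]])
    show "0 < r\<^sup>2 - r * w" using r w(1) by (simp add: power2_eq_square)
    show "(r\<^sup>2 - r * w) * (norm x)\<^sup>2 \<le> Re (cinner (\<Sum>j<d. scaleC (- cnj (z j)) (A j x)) x)" for x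
    proof (cases "x = 0")
      case False
      define S where "S y = (\<Sum>j<d. scaleC (- cnj (z j)) (A j y))" for y
      define u where "u = (1 / norm x) *\<^sub>R x"
      have u: "norm u = 1" "x = norm x *\<^sub>R u" using False by (simp_all add: u_def)
      have "A j (norm x *\<^sub>R u) = norm x *\<^sub>R A j u" if "j < d" for j
        unfolding A_def by (rule linear_scale[OF bounded_linear.linear[OF bounded_linear_diff_scaleC[OF T[OF that]]]])
      then have "S (norm x *\<^sub>R u) = norm x *\<^sub>R S u"
        unfolding S_def scaleR_sum_right
        by (intro sum.cong refl) (simp add: scaleR_scaleC scaleC_scaleC mult.commute)
      then have "cinner (S x) x = of_real ((norm x)\<^sup>2) * cinner (S u) u"
        by (subst (1 2) u(2)) (simp add: cinner_scaleR_left cinner_scaleR_right power2_eq_square)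
      then have "Re (cinner (S x) x) = (norm x)\<^sup>2 * Re (cinner (S u) u)"
        by (simp only: Re_complex_of_real times_complex.sel Im_complex_of_real mult_zero_left diff_zero)
      then show ?thesis
        using mult_left_mono[OF unit[OF u(1)], of "(norm x)\<^sup>2"] by (simp add: S_def mult.commute)
    qed simp
  qed (use cA in auto)
  then show False using z by (simp add: taylor_spectrum_def A_def)
qed

section \<open>The inequalities between the three radii and the case of equality\<close>

theorem theorem2p13:
  fixes T :: "nat \<Rightarrow> 'a::complex_hilbert_space \<Rightarrow> 'a" and d :: nat
  assumes "d \<ge> 1"
    and "\<forall>k<d. bounded_clinear (T k)"
    and "\<forall>i<d. \<forall>j<d. T i \<circ> T j = T j \<circ> T i"
  shows "joint_spectral_radius d T = joint_norm d T \<longleftrightarrow> joint_numerical_radius d T = joint_norm d T"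
proof (cases "\<exists>x::'a. norm x = 1")
  case False
  have triv: "x = 0" for x :: 'a
  proof (rule ccontr)
    assume "x \<noteq> 0"
    then have "norm ((1 / norm x) *\<^sub>R x) = 1" by simp
    then show False using False by blast
  qed
  have eq: "x = y" for x y :: 'a using triv by metis
  \<comment> \<open>In the zero space all vectors agree, so any \<open>B\<close> contracts the
    complex.\<close>
  have "koszul_exact d A TYPE('a)" for A :: "nat \<Rightarrow> 'a \<Rightarrow> 'a"
    by (rule koszul_exact_if_unimodular[where B = A]) (rule eq linearI)+
  \<comment> \<open>All three radii are the unspecified value \<open>Sup {}\<close>.\<close>
  then have "taylor_spectrum d T = {}" by (simp add: taylor_spectrum_def)
  moreover have "{x::'a. norm x = 1} = {}" using False by blast
  ultimately show ?thesis
    by (simp only: joint_spectral_radius_def joint_norm_def joint_numerical_radius_def image_empty)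
next
  case True
  define wf where "wf x = sqrt (\<Sum>k<d. (cmod (cinner (T k x) x))\<^sup>2)" for x
  define nf where "nf x = sqrt (\<Sum>k<d. (norm (T k x))\<^sup>2)" for x
  define W where "W = joint_numerical_radius d T"
  define N where "N = joint_norm d T"
  have T: "bounded_clinear (T k)" if "k < d" for k using assms(2) that by blast
  have comm: "T i (T j x) = T j (T i x)" if "i < d" "j < d" for i j x
    using assms(3) that by (metis comp_apply)
  have WN: "W = Sup (wf ` {x. norm x = 1})" "N = Sup (nf ` {x. norm x = 1})"
    by (simp_all add: W_def N_def joint_numerical_radius_def joint_norm_def wf_def[abs_def] nf_def[abs_def])
  have wn: "wf x \<le> nf x" if "norm x = 1" for x
    unfolding wf_def nf_def using cmod_cinner_le[OF that] by (intro real_sqrt_le_mono sum_mono power_mono) auto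
  have "\<forall>j. \<exists>K. j < d \<longrightarrow> (\<forall>x. norm (T j x) \<le> norm x * K)"
    using T bounded_linear.bounded unfolding bounded_clinear_def by blast
  then obtain K where K: "\<And>j x. j < d \<Longrightarrow> norm (T j x) \<le> norm x * K j" by metis
  have bdn: "nf x \<le> sqrt (\<Sum>k<d. (K k)\<^sup>2)" if "norm x = 1" for x
    unfolding nf_def using K[of _ x] that by (intro real_sqrt_le_mono sum_mono power_mono) auto
  have nfN: "nf x \<le> N" if "norm x = 1" for x
    unfolding WN using bdn that by (intro cSup_upper bdd_aboveI2) auto
  have wfW: "wf x \<le> W" if "norm x = 1" for x
    unfolding WN using bdn wn that by (intro cSup_upper bdd_aboveI2) (auto intro: order_trans)
  have "W \<le> N"
    unfolding WN(1) using True wn nfN by (intro cSup_least) (auto intro: order_trans)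
  have "0 \<le> W"
  proof -
    obtain x :: 'a where "norm x = 1" using True by blast
    then show ?thesis using wfW[of x] by (smt (verit) real_sqrt_ge_zero sum_nonneg wf_def zero_le_power2)
  qed
  have spec: "sqrt (\<Sum>j<d. (cmod (z j))\<^sup>2) \<le> W" if "z \<in> taylor_spectrum d T" for z
    by (rule taylor_spectrum_le_numerical_radius[OF T comm \<open>0 \<le> W\<close> _ that]) (use wfW in \<open>auto simp: wf_def\<close>)
  define r where "r = joint_spectral_radius d T"
  have le_r: "sqrt (\<Sum>j<d. (cmod (z j))\<^sup>2) \<le> r" if "z \<in> taylor_spectrum d T" for z
    unfolding r_def joint_spectral_radius_def using that spec by (intro cSup_upper bdd_aboveI2) auto
  \<comment> \<open>Otherwise \<open>r\<close> would be the unspecified supremum of the empty set,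
    with no reason for \<open>r \<le> W\<close>.\<close>
  have "taylor_spectrum d T \<noteq> {}"
  proof -
    obtain l where "approximate_joint_eigenvalue d T l"
      using approximate_joint_eigenvalue_exists[of d T, OF T comm True] by blast
    from approximate_joint_eigenvalue_in_taylor_spectrum[of d T, OF assms(1) T comm this] show ?thesis by blast
  qed
  then have "r \<le> W"
    unfolding r_def joint_spectral_radius_def using spec by (intro cSup_least) auto
  \<comment> \<open>With r \<le> W \<le> N, (a) forces (b) at once, and this is all that (b) still
    has to yield.\<close>
  have "N \<le> r" if eq: "W = N"
  proof -
    have "\<exists>x. norm x = 1 \<and> N - inverse (real (Suc n)) < wf x" for n
    proof -
      have "N - inverse (real (Suc n)) < Sup (wf ` {x. norm x = 1})" using eq WN(1) by simp
      then show ?thesis using True less_cSupD[of "wf ` {x. norm x = 1}"] by auto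
    qed
    then obtain x where x: "\<And>n. norm (x n) = 1" "\<And>n. N - inverse (real (Suc n)) < wf (x n)" by metis
    define f where "f j n = cinner (T j (x n)) (x n)" for j n
    have "bounded (range (f j))" if "j < d" for j
    proof -
      have "cmod (f j n) \<le> K j" for n
        using cmod_cinner_le[OF x(1), of "T j (x n)" n] K[OF that, of "x n"] x(1)[of n] by (simp add: f_def)
      then show ?thesis by (auto simp: bounded_iff)
    qed
    then obtain s l where s: "strict_mono (s :: nat \<Rightarrow> nat)" and l: "\<forall>j<d. (\<lambda>n. f j (s n)) \<longlonglongrightarrow> l j"
      using simultaneous_convergent_subsequence[of d f] by blast
    have "(\<lambda>n. wf (x n)) \<longlonglongrightarrow> N"
    proof (rule tendsto_sandwich)
      show "(\<lambda>n. N - inverse (real (Suc n))) \<longlonglongrightarrow> N"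
        using tendsto_diff[OF tendsto_const LIMSEQ_inverse_real_of_nat, of N] by simp
      show "eventually (\<lambda>n. N - inverse (real (Suc n)) \<le> wf (x n)) sequentially"
        using x(2) by (intro always_eventually allI less_imp_le)
      show "eventually (\<lambda>n. wf (x n) \<le> N) sequentially"
        using wfW x(1) eq by auto
    qed simp
    from LIMSEQ_subseq_LIMSEQ[OF this s] have wN: "(\<lambda>n. wf (x (s n))) \<longlonglongrightarrow> N" by (simp add: o_def)
    have "(\<lambda>n. wf (x (s n))) \<longlonglongrightarrow> sqrt (\<Sum>j<d. (cmod (l j))\<^sup>2)"
      unfolding wf_def f_def[symmetric] using l by (intro tendsto_intros) auto
    with wN have Nl: "N = sqrt (\<Sum>j<d. (cmod (l j))\<^sup>2)" by (rule LIMSEQ_unique)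
    \<comment> \<open>One squared defect is at most the sum of all, which Pythagoras evaluates. The
      vectors were chosen for \<open>wf\<close>, so \<open>nf\<close> is controlled only by its
      supremum N; W = N makes this enough.\<close>
    have gap: "(norm (T j (x n) - scaleC (f j n) (x n)))\<^sup>2 \<le> N\<^sup>2 - (wf (x n))\<^sup>2" if j: "j < d" for j n
    proof -
      have "(norm (T j (x n) - scaleC (f j n) (x n)))\<^sup>2 \<le> (\<Sum>j<d. (norm (T j (x n) - scaleC (f j n) (x n)))\<^sup>2)"
        using j by (intro member_le_sum[of j "{..<d}" "\<lambda>j. (norm (T j (x n) - scaleC (f j n) (x n)))\<^sup>2"]) auto
      also have "\<dots> = (nf (x n))\<^sup>2 - (wf (x n))\<^sup>2"
        by (simp add: f_def norm_diff_projection_sq[OF x(1)] sum_subtractf nf_def wf_def sum_nonneg)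
      also have "(nf (x n))\<^sup>2 \<le> N\<^sup>2" using nfN[OF x(1)] by (intro power_mono) (auto simp: nf_def sum_nonneg)
      finally show ?thesis by simp
    qed
    have "(\<lambda>n. norm (T j (x (s n)) - scaleC (l j) (x (s n)))) \<longlonglongrightarrow> 0" if j: "j < d" for j
    proof (rule tendsto_sandwich[where f = "\<lambda>_. 0"])
      \<comment> \<open>The root bounds the defect for the moving value \<open>f j (s n)\<close>;
        the second term is the cost of replacing it by its limit.\<close>
      show "eventually (\<lambda>n. norm (T j (x (s n)) - scaleC (l j) (x (s n))) \<le> sqrt (N\<^sup>2 - (wf (x (s n)))\<^sup>2) + cmod (f j (s n) - l j)) sequentially"
      proof (intro always_eventually allI)
        fix n
        have "T j (x (s n)) - scaleC (l j) (x (s n))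
            = (T j (x (s n)) - scaleC (f j (s n)) (x (s n))) + scaleC (f j (s n) - l j) (x (s n))"
          by (simp add: scaleC_diff_left)
        then have "norm (T j (x (s n)) - scaleC (l j) (x (s n)))
            \<le> norm (T j (x (s n)) - scaleC (f j (s n)) (x (s n))) + norm (scaleC (f j (s n) - l j) (x (s n)))"
          by (simp only: norm_triangle_ineq)
        also have "\<dots> \<le> sqrt (N\<^sup>2 - (wf (x (s n)))\<^sup>2) + cmod (f j (s n) - l j)"
          using real_le_rsqrt[OF gap[OF j, of "s n"]] by (simp add: x(1))
        finally show "norm (T j (x (s n)) - scaleC (l j) (x (s n))) \<le> sqrt (N\<^sup>2 - (wf (x (s n)))\<^sup>2) + cmod (f j (s n) - l j)" .
      qed
      have "(\<lambda>n. sqrt (N\<^sup>2 - (wf (x (s n)))\<^sup>2) + cmod (f j (s n) - l j)) \<longlonglongrightarrow> sqrt (N\<^sup>2 - N\<^sup>2) + cmod (l j - l j)"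
        using wN l j by (intro tendsto_intros) auto
      then show "(\<lambda>n. sqrt (N\<^sup>2 - (wf (x (s n)))\<^sup>2) + cmod (f j (s n) - l j)) \<longlonglongrightarrow> 0" by simp
    qed auto
    then have ev: "eventually (\<lambda>n. norm (T j (x (s n)) - scaleC (l j) (x (s n))) < \<epsilon>) sequentially"
      if "j \<in> {..<d}" "\<epsilon> > 0" for j \<epsilon>
      using order_tendstoD(2) that by fastforce
    have "approximate_joint_eigenvalue d T l"
      unfolding approximate_joint_eigenvalue_def
    proof (intro allI impI)
      fix \<epsilon> :: real assume "\<epsilon> > 0"
      then have "eventually (\<lambda>n. \<forall>j\<in>{..<d}. norm (T j (x (s n)) - scaleC (l j) (x (s n))) < \<epsilon>) sequentially"
        using ev by (intro eventually_ball_finite) auto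
      then obtain n where "\<forall>j\<in>{..<d}. norm (T j (x (s n)) - scaleC (l j) (x (s n))) < \<epsilon>"
        by (auto simp: eventually_sequentially)
      then show "\<exists>x. norm x = 1 \<and> (\<forall>j<d. norm (T j x - scaleC (l j) x) \<le> \<epsilon>)"
        using x(1)[of "s n"] by (auto intro!: exI[of _ "x (s n)"] less_imp_le)
    qed
    from approximate_joint_eigenvalue_in_taylor_spectrum[of d T, OF assms(1) T comm this]
    have "(\<lambda>j. if j < d then l j else 0) \<in> taylor_spectrum d T" .
    from le_r[OF this] show ?thesis by (simp add: Nl)
  qed
  then show ?thesis using \<open>r \<le> W\<close> \<open>W \<le> N\<close> unfolding r_def W_def N_def by linarith
qed

end
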